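(* Let $T$ be a tree of order $n$ and leaf order $\ell$ that is not a star. (a) - If $\ell < \frac{n}{3}$, then $\iota(T) \le \frac{n+\ell}{4} < \frac{n}{3}$. - If $\ell = \frac{n}{3}$, then $\iota(T) \le \frac{n+\ell}{4} = \frac{n-\ell}{2} = \frac{n}{3}$. - If $\ell > \frac{n}{3}$, then $\iota(T) \le \frac{n-\ell}{2} < \frac{n}{3}$. (b) Let $k \geq 2$ be an integer. - If $\ell < \frac{k-1}{k+2}n$, then $\iota_k(T) \le \frac{n+\ell}{2k+1} < \frac{n}{k+2}$. - If $\ell = \frac{k-1}{k+2}n$, then $\iota_k(T) \le \frac{n+\ell}{2k+1} = \frac{n}{k+2}$. - If $\frac{k-1}{k+2}n < \ell < \frac{k}{k+2}n$, then $\iota_k(T) \le \frac{n}{k+2}$. - If $\ell = \frac{k}{k+2}n$, then $\iota_k(T) \le \frac{n-\ell}{2} = \frac{n}{k+2}$. - If $\ell > \frac{k}{k+2}n$, then $\iota_k(T) \le \frac{n-\ell}{2} < \frac{n}{k+2}$. Moreover, the bounds are sharp; that is, in each case of (a), and for each $k \ge 2$ in each case of (b), there is a non-star tree satisfying the condition of the case for which the stated upper bound on $\iota$ (respectively $\iota_k$) is attained with equality.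
   Context: Graphs are finite and simple. A leaf is a vertex of degree $1$; the leaf order is the number of leaves; the order is the number of vertices. A star is a graph isomorphic to $K_{1,m}$ for some $m\ge 1$. For $D\subseteq V(G)$, $N[D]$ is the set consisting of the vertices of $D$ and all their neighbours. For $k\ge 1$, a $k$-isolating set of $G$ is a set $D\subseteq V(G)$ (possibly empty) such that $G-N[D]$ contains no subgraph isomorphic to $K_{1,k}$ (equivalently, the maximum degree of $G-N[D]$ is at most $k-1$). The $k$-isolation number $\iota_k(G)$ is the size of a smallest $k$-isolating set of $G$, and $\iota(G)=\iota_1(G)$. *)

theory Defs
  imports Complex_Main "Graph_Theory.Graph_Theory"
begin

text \<open>
  A finite simple graph is a \<^term>\<open>G\<close> with \<^prop>\<open>graph G\<close>, that is, a finite symmetric digraph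
  without loops and parallel arcs. Each edge \<open>uv\<close> is the pair of opposite arcs \<open>(u,v)\<close>, \<open>(v,u)\<close>,
  so the degree of a vertex is its \<^const>\<open>out_degree\<close>.
\<close>

text \<open>
  \<^const>\<open>forest\<close> and \<^const>\<open>tree\<close> from the library are not usable for symmetric digraphs, because
  \<open>u, v, u\<close> is a directed cycle as soon as there is an edge \<open>uv\<close>. The cycles of an undirected
  simple graph are exactly the directed ones of length at least 3. A tree has at least one vertex,
  as \<open>connected\<close> excludes the null graph.
\<close>

definition undirected_tree :: "('a,'b) pre_digraph \<Rightarrow> bool" where
  "undirected_tree G \<longleftrightarrow> graph G \<and> Digraph_Component.connected G \<and>
     \<not> (\<exists>p. pre_digraph.cycle G p \<and> length p \<ge> 3)"

text \<open>\<^term>\<open>K\<^bsub>1,m\<^esub> G\<close> says that \<^term>\<open>G\<close> is isomorphic to the star with \<^term>\<open>m\<close> edges.\<close>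

definition is_star :: "('a,'b) pre_digraph \<Rightarrow> bool" where
  "is_star G \<longleftrightarrow> (\<exists>m\<ge>1. K\<^bsub>1,m\<^esub> G)"

definition leaf_order :: "('a,'b) pre_digraph \<Rightarrow> nat" where
  "leaf_order G = card {v \<in> verts G. out_degree G v = 1}"

definition closed_nbhd :: "('a,'b) pre_digraph \<Rightarrow> 'a set \<Rightarrow> 'a set" where
  "closed_nbhd G D = D \<union> {v. \<exists>u\<in>D. u \<rightarrow>\<^bsub>G\<^esub> v}"

definition isolating_set :: "nat \<Rightarrow> ('a,'b) pre_digraph \<Rightarrow> 'a set \<Rightarrow> bool" where
  "isolating_set k G D \<longleftrightarrow> D \<subseteq> verts G \<and>
     \<not> (\<exists>H. subgraph H (G \<restriction> (verts G - closed_nbhd G D)) \<and> K\<^bsub>1,k\<^esub> H)"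

text \<open>Only meaningful for \<open>k \<ge> 1\<close>, where \<^term>\<open>verts G\<close> itself is always isolating.\<close>

definition isolation_number :: "nat \<Rightarrow> ('a,'b) pre_digraph \<Rightarrow> nat" where
  "isolation_number k G = (LEAST m. \<exists>D. isolating_set k G D \<and> card D = m)"

end

theory Submission
  imports Defs
begin

text \<open>
  The theorem follows from three upper bounds for the \<open>k\<close>-isolation number \<open>i\<close> of a tree with \<open>n\<close>
  vertices and \<open>l\<close> leaves that is not a star: \<open>2 * i \<le> n - l\<close> and \<open>(k + 2) * i \<le> n\<close> for \<open>k \<ge> 1\<close>, and
  \<open>c * i \<le> n + l\<close>, where \<open>c = 4\<close> for \<open>k = 1\<close> and \<open>c = 2 * k + 1\<close> for \<open>k \<ge> 2\<close>. The thresholds for \<open>l\<close> are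
  the places where two of these bounds agree.

  The last two bounds come from the same greedy induction on a rooted tree
  (\<open>isolating_set_of_order\<close>, \<open>isolating_set_of_childless\<close>). Choose a vertex \<open>d\<close> as low as possible whose
  branch still contains a large star near its top. Then \<open>d\<close> alone isolates the branch, and it dominates
  its parent, so the branch can be cut off, possibly together with the parent, and the induction
  continues with the rest of the tree (\<open>isolates_insert\<close>). The branch is large enough to pay for \<open>d\<close>:
  it has \<open>k + 2\<close> vertices, respectively its vertices and leaves together number \<open>c\<close>. The delicate
  point for the leaf bound is that cutting may turn the parent into a new leaf; removing the parent as
  well balances the account.

  The first bound is the case \<open>k = 0\<close> of \<open>isolating_set_of_order\<close>, where isolating means
  dominating: a set that dominates the tree of non-leaves leaves only pairwise non-adjacent leaves
  undominated.

  For sharpness, all witnesses are caterpillars with stars so far apart along the spine that each vertex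
  of an isolating set takes care of at most one of them (\<open>card_le_isolating_set\<close>).
\<close>

section \<open>Isolating sets\<close>

text \<open>
  Closed neighbourhoods and isolating sets for a bare edge relation, so that the vertex set can shrink
  during an induction while the edges stay the same.
\<close>

definition dominated :: "('a \<times> 'a) set \<Rightarrow> 'a set \<Rightarrow> 'a set" where
  "dominated E D = D \<union> E `` D"

definition isolates :: "('a \<times> 'a) set \<Rightarrow> nat \<Rightarrow> 'a set \<Rightarrow> 'a set \<Rightarrow> bool" where
  "isolates E k V D \<longleftrightarrow> D \<subseteq> V \<and>
     (\<forall>x\<in>V - dominated E D. card (E `` {x} \<inter> (V - dominated E D)) < k)"

text \<open>
  The gluing step of every induction below: one more vertex \<open>d\<close> takes care of the removed part
  \<open>V - V1\<close>, provided that each edge between the two parts loses an endpoint to \<open>d\<close>, so that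
  neither part sees the other once the closed neighbourhoods are gone.
\<close>

lemma isolates_insert:
  assumes "finite V" "V1 \<subseteq> V" "d \<in> V"
    and iso: "isolates E k V1 D"
    and rest: "\<And>x. x \<in> V - V1 - dominated E {d} \<Longrightarrow>
                 card (E `` {x} \<inter> (V - dominated E {d})) < k"
    and cross: "\<And>x y. x \<in> V1 \<Longrightarrow> y \<in> V - V1 \<Longrightarrow> (x, y) \<in> E \<Longrightarrow>
                  x \<in> dominated E {d} \<or> y \<in> dominated E {d}"
  shows "isolates E k V (insert d D)"
  unfolding isolates_def
proof (intro conjI ballI)
  show "insert d D \<subseteq> V"
    using assms by (auto simp: isolates_def)
  have dom: "dominated E (insert d D) = dominated E {d} \<union> dominated E D"
    by (auto simp: dominated_def)
  fix x assume x: "x \<in> V - dominated E (insert d D)"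
  show "card (E `` {x} \<inter> (V - dominated E (insert d D))) < k"
  proof (cases "x \<in> V1")
    case True
    then have "E `` {x} \<inter> (V - dominated E (insert d D)) \<subseteq> E `` {x} \<inter> (V1 - dominated E D)"
      using cross[OF True] x unfolding dom by blast
    moreover have "finite (E `` {x} \<inter> (V1 - dominated E D))"
      using assms(1,2) finite_subset by blast
    ultimately have "card (E `` {x} \<inter> (V - dominated E (insert d D)))
        \<le> card (E `` {x} \<inter> (V1 - dominated E D))"
      by (simp add: card_mono)
    also have "\<dots> < k"
      using iso x True unfolding isolates_def dom by blast
    finally show ?thesis .
  next
    case False
    have "card (E `` {x} \<inter> (V - dominated E (insert d D)))
        \<le> card (E `` {x} \<inter> (V - dominated E {d}))"
      using assms(1) unfolding dom by (intro card_mono) auto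
    also have "\<dots> < k"
      using rest x False unfolding dom by blast
    finally show ?thesis .
  qed
qed

lemma isolates_cong:
  assumes "E \<inter> V \<times> V = E' \<inter> V \<times> V"
  shows "isolates E k V D \<longleftrightarrow> isolates E' k V D"
proof (cases "D \<subseteq> V")
  case True
  have EE: "(x, y) \<in> E \<longleftrightarrow> (x, y) \<in> E'" if "x \<in> V" "y \<in> V" for x y
    using assms that by blast
  have *: "V - dominated E D = V - dominated E' D"
    using EE True unfolding dominated_def by blast
  have "E `` {x} \<inter> (V - W) = E' `` {x} \<inter> (V - W)" if "x \<in> V" for x W
    using EE that by auto
  then show ?thesis
    unfolding isolates_def * by auto
qed (simp add: isolates_def)

lemma isolates_small:
  assumes "finite V" "card V \<le> k" "\<And>x. x \<in> V \<Longrightarrow> (x, x) \<notin> E"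
  shows "isolates E k V {}"
  unfolding isolates_def
proof (intro conjI ballI)
  fix x assume x: "x \<in> V - dominated E {}"
  then have "card (E `` {x} \<inter> (V - dominated E {})) \<le> card (V - {x})"
    using assms by (intro card_mono) auto
  also have "\<dots> < card V"
    using x assms(1) by (metis DiffD1 card_Diff1_less)
  finally show "card (E `` {x} \<inter> (V - dominated E {})) < k"
    using assms(2) by simp
qed simp

section \<open>Rooted trees\<close>

text \<open>
  A rooted tree is a root, a parent function and a rank that decreases towards the root. The three
  parameters carry no assumption of their own: which vertex sets they make into a rooted tree is the
  predicate \<open>rooted\<close>, so pruning a branch changes only the set. The rank replaces the depth; any
  measure that decreases along \<open>par\<close> will do.
\<close>

locale parent_map =
  fixes r :: 'a and par :: "'a \<Rightarrow> 'a" and rank :: "'a \<Rightarrow> nat"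
begin

definition edges :: "('a \<times> 'a) set" where
  "edges = {(x, y). x \<noteq> r \<and> y = par x \<or> y \<noteq> r \<and> x = par y}"

definition rooted :: "'a set \<Rightarrow> bool" where
  "rooted V \<longleftrightarrow> finite V \<and> r \<in> V \<and> (\<forall>v\<in>V - {r}. par v \<in> V \<and> rank (par v) < rank v)"

definition children :: "'a set \<Rightarrow> 'a \<Rightarrow> 'a set" where
  "children V v = {w \<in> V - {r}. par w = v}"

definition below :: "'a \<Rightarrow> 'a set" where
  "below v = {w. (w, v) \<in> {(x, par x) |x. x \<noteq> r}\<^sup>*}"

definition childless :: "'a set \<Rightarrow> 'a set" where
  "childless V = {v \<in> V. children V v = {}}"

lemma sym_edges: "sym edges"
  by (auto simp: edges_def sym_def)

lemma rooted_finite: "rooted V \<Longrightarrow> finite V"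
  by (simp add: rooted_def)

lemma rooted_par: "rooted V \<Longrightarrow> v \<in> V \<Longrightarrow> v \<noteq> r \<Longrightarrow> par v \<in> V"
  and rooted_rank: "rooted V \<Longrightarrow> v \<in> V \<Longrightarrow> v \<noteq> r \<Longrightarrow> rank (par v) < rank v"
  by (auto simp: rooted_def)

lemma irrefl_edges: "rooted V \<Longrightarrow> x \<in> V \<Longrightarrow> (x, x) \<notin> edges"
  using rooted_rank[of V x] by (auto simp: edges_def)

lemma below_refl [simp]: "v \<in> below v"
  by (simp add: below_def)

lemma below_child: "w \<noteq> r \<Longrightarrow> par w \<in> below v \<Longrightarrow> w \<in> below v"
  by (auto simp: below_def intro: converse_rtrancl_into_rtrancl)

lemma below_cases: "w \<in> below v \<Longrightarrow> w = v \<or> w \<noteq> r \<and> par w \<in> below v"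
  by (auto simp: below_def elim: converse_rtranclE)

lemma below_trans: "u \<in> below v \<Longrightarrow> v \<in> below w \<Longrightarrow> u \<in> below w"
  by (auto simp: below_def)

lemma below_root: "r \<in> below v \<Longrightarrow> v = r"
  using below_cases by blast

lemma below_comparable:
  assumes "x \<in> below v" "x \<in> below w"
  shows "v \<in> below w \<or> w \<in> below v"
  using assms unfolding below_def mem_Collect_eq
proof (induction rule: converse_rtrancl_induct)
  case (step x y)
  then have y: "y = par x" "x \<noteq> r" by auto
  show ?case
  proof (cases "x = w")
    case True
    then show ?thesis
      using step.hyps by (auto intro: converse_rtrancl_into_rtrancl)
  next
    case False
    then show ?thesis
      using step.IH below_cases[of x w] step.prems y by (auto simp: below_def)
  qed
qed auto

lemma below_rank:
  assumes "rooted V" "w \<in> V" "w \<in> below v"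
  shows "v \<in> V \<and> (w = v \<or> rank v < rank w)"
  using assms(3,2) unfolding below_def mem_Collect_eq
proof (induction rule: converse_rtrancl_induct)
  case (step x y)
  then have y: "y = par x" "x \<noteq> r" by auto
  then show ?case
    using step.IH step.prems rooted_par[OF assms(1) step.prems y(2)]
      rooted_rank[OF assms(1) step.prems y(2)] by auto
qed simp

lemma par_not_below:
  assumes "rooted V" "d \<in> V" "d \<noteq> r"
  shows "par d \<notin> below d"
  using below_rank[OF assms(1) rooted_par[OF assms], of d] rooted_rank[OF assms] by auto

lemma all_below_root:
  assumes "rooted V" "v \<in> V"
  shows "v \<in> below r"
  using assms(2)
proof (induction v rule: measure_induct_rule[of rank])
  case (less v)
  show ?case
  proof (cases "v = r")
    case False
    then show ?thesis
      using less.IH[of "par v"] rooted_par[OF assms(1) less.prems] rooted_rank[OF assms(1) less.prems]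
        below_child[of v r] by simp
  qed simp
qed

lemma rooted_prune:
  assumes "rooted V" "d \<noteq> r"
  shows "rooted (V - below d)"
  unfolding rooted_def
proof (intro conjI ballI)
  fix v assume v: "v \<in> V - below d - {r}"
  then show "par v \<in> V - below d" "rank (par v) < rank v"
    using rooted_par[OF assms(1), of v] rooted_rank[OF assms(1), of v] below_child[of v d] by auto
qed (use assms below_root in \<open>auto simp: rooted_def\<close>)

lemma below_cross:
  assumes "x \<notin> below d" "y \<in> below d" "(x, y) \<in> edges"
  shows "y = d \<and> x = par d"
  using assms below_child[of x d] below_cases[of y d] by (auto simp: edges_def)

lemma childrenD: "w \<in> children V v \<Longrightarrow> w \<in> V \<and> w \<noteq> r \<and> par w = v"
  by (simp add: children_def)

lemma finite_children: "rooted V \<Longrightarrow> finite (children V v)"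
  by (simp add: children_def rooted_def)

lemma children_below: "w \<in> children V v \<Longrightarrow> v \<in> below d \<Longrightarrow> w \<in> V \<inter> below d"
  using below_child[of w d] by (auto simp: children_def)

lemma child_rank: "rooted V \<Longrightarrow> w \<in> children V v \<Longrightarrow> rank v < rank w"
  using rooted_rank[of V w] by (auto simp: children_def)

text \<open>
  After removing the closed neighbourhood of \<open>d\<close>, a vertex of the branch at \<open>d\<close> that is two
  levels down has lost its parent, so only its children count; further down the parent may survive and
  contributes one more neighbour. This is why the second bound is stricter by one.
\<close>

lemma isolated_below:
  assumes "rooted V" "d \<in> V"
    and ch: "\<And>e w. e \<in> V \<inter> below d - {d} \<Longrightarrow> w \<in> children V e \<Longrightarrow> card (children V w) < k"
    and gch: "\<And>e w u. e \<in> V \<inter> below d - {d} \<Longrightarrow> w \<in> children V e \<Longrightarrow> u \<in> children V w \<Longrightarrow>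
                card (children V u) + 1 < k"
    and x: "x \<in> V \<inter> below d - dominated edges {d}"
  shows "card (edges `` {x} \<inter> (V - dominated edges {d})) < k"
proof -
  have xd: "x \<noteq> d" "(d, x) \<notin> edges"
    using x by (auto simp: dominated_def)
  then have px: "x \<noteq> r" "par x \<in> below d" "par x \<noteq> d" "par x \<in> V"
    using x below_cases[of x d] rooted_par[OF assms(1), of x] by (auto simp: edges_def)
  have xch: "x \<in> children V (par x)"
    using x px by (auto simp: children_def)
  have nb: "edges `` {x} \<inter> (V - dominated edges {d}) \<subseteq> insert (par x) (children V x)"
    by (auto simp: edges_def children_def)
  show ?thesis
  proof (cases "par x \<in> dominated edges {d}")
    case True
    then have "edges `` {x} \<inter> (V - dominated edges {d}) \<subseteq> children V x"
      using nb by auto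
    then have "card (edges `` {x} \<inter> (V - dominated edges {d})) \<le> card (children V x)"
      using finite_children[OF assms(1)] card_mono by blast
    also have "\<dots> < k"
      using ch[OF _ xch] px by blast
    finally show ?thesis .
  next
    case False
    then have ppx: "par x \<noteq> r" "par (par x) \<in> below d" "par (par x) \<noteq> d" "par (par x) \<in> V"
      using px below_cases[of "par x" d] rooted_par[OF assms(1), of "par x"]
      by (auto simp: edges_def dominated_def)
    have "card (edges `` {x} \<inter> (V - dominated edges {d})) \<le> card (insert (par x) (children V x))"
      using nb finite_children[OF assms(1)] by (intro card_mono) auto
    also have "\<dots> \<le> card (children V x) + 1"
      by (simp add: card_insert_le_m1 le_diff_conv card_insert_if finite_children[OF assms(1)])
    also have "\<dots> < k"
      using gch[OF _ _ xch, of "par (par x)"] ppx px by (auto simp: children_def)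
    finally show ?thesis .
  qed
qed

text \<open>
  With the root as a fallback when no vertex satisfies \<open>P\<close>, the two cases "a lowest bad branch" and
  "no bad branch at all" can share one local argument.
\<close>

lemma lowest_vertex:
  assumes "rooted V"
  shows "\<exists>d\<in>V. (d = r \<or> P d) \<and> (\<forall>e\<in>V \<inter> below d - {d}. \<not> P e)"
proof -
  define S where "S = insert r {d \<in> V. P d}"
  have S: "finite S" "S \<noteq> {}" "S \<subseteq> V"
    using assms by (auto simp: S_def rooted_def)
  then have "Max (rank ` S) \<in> rank ` S"
    by (intro Max_in) auto
  then obtain d where d: "d \<in> S" "rank d = Max (rank ` S)"
    by auto
  have "\<not> P e" if e: "e \<in> V \<inter> below d - {d}" for e
  proof
    assume "P e"
    then have "rank e \<le> rank d"
      using d e S by (auto simp: S_def)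
    then show False
      using below_rank[OF assms, of e d] e by auto
  qed
  then show ?thesis
    using d S by (auto simp: S_def)
qed

end

section \<open>The bound by the order\<close>

context parent_map
begin

text \<open>
  Cut off a lowest branch whose root \<open>d\<close> is the parent or grandparent of the centre of a star with
  \<open>k\<close> edges: it has at least \<open>k + 2\<close> vertices, and \<open>d\<close> alone isolates it. If the remaining tree has at
  least \<open>k + 2\<close> vertices, recurse. If it is smaller, then \<open>d\<close> already isolates everything: it dominates
  its parent, and what is left has at most \<open>k\<close> vertices and so no vertex with \<open>k\<close> neighbours. For
  \<open>k = 0\<close> this is the theorem that a tree with at least two vertices has a dominating set of at most
  half of its vertices.
\<close>

theorem isolating_set_of_order:
  assumes "rooted V" "k + 2 \<le> card V"
  obtains D where "isolates edges k V D" "(k + 2) * card D \<le> card V"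
proof -
  have "\<exists>D. isolates edges k V D \<and> (k + 2) * card D \<le> card V"
    using assms
  proof (induction "card V" arbitrary: V rule: less_induct)
    case less
    note V = less.prems(1) and fin = rooted_finite[OF less.prems(1)]
    \<comment> \<open>The parent \<open>d\<close> of the centre \<open>w\<close> of a star, or the grandparent of the centre \<open>u\<close> of a star that
        has \<open>w\<close> among its leaves: in both cases \<open>d\<close>, \<open>w\<close> and the star have \<open>k + 2\<close> vertices.\<close>
    define bad where "bad d \<longleftrightarrow> (\<exists>w\<in>children V d. k \<le> card (children V w) \<or>
        (\<exists>u\<in>children V w. k \<le> card (children V u) + 1))" for d
    obtain d where d: "d \<in> V" "d = r \<or> bad d" "\<forall>e\<in>V \<inter> below d - {d}. \<not> bad e"
      using lowest_vertex[OF V, of bad] by auto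
    have loc: "card (edges `` {x} \<inter> (V - dominated edges {d})) < k"
      if x: "x \<in> V \<inter> below d - dominated edges {d}" for x
    proof (rule isolated_below[OF V d(1) _ _ x])
      fix e w assume e: "e \<in> V \<inter> below d - {d}" and w: "w \<in> children V e"
      have "\<not> bad e"
        using d(3) e by blast
      with w show "card (children V w) < k"
        unfolding bad_def by (simp add: not_le)
      fix u assume "u \<in> children V w"
      with \<open>\<not> bad e\<close> w show "card (children V u) + 1 < k"
        unfolding bad_def by (simp add: not_le)
    qed
    show ?case
    proof (cases "d = r")
      case True
      then have "isolates edges k V {d}"
        using loc d(1) all_below_root[OF V] by (auto simp: isolates_def)
      then show ?thesis
        using less.prems(2) by (intro exI[of _ "{d}"]) simp
    next
      case False
      have sub: "card (V \<inter> below d) \<ge> k + 2"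
      proof -
        obtain w where w: "w \<in> children V d"
          and "k \<le> card (children V w) \<or> (\<exists>u\<in>children V w. k \<le> card (children V u) + 1)"
          using d(2) False by (auto simp: bad_def)
        then consider "k \<le> card (children V w)"
          | u where "u \<in> children V w" "k \<le> card (children V u) + 1" by blast
        then show ?thesis
        proof cases
          case 1
          have "{d, w} \<union> children V w \<subseteq> V \<inter> below d"
            using d(1) children_below[OF w, of d] children_below[of _ V w d] by auto
          moreover have "card ({d, w} \<union> children V w) = 2 + card (children V w)"
            using child_rank[OF V w] child_rank[OF V, of d w] child_rank[OF V, of w w]
              finite_children[OF V, of w]
            by (subst card_Un_disjoint) (auto simp: card_insert_if)
          ultimately show ?thesis
            using 1 card_mono[of "V \<inter> below d" "{d, w} \<union> children V w"] fin by simp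
        next
          case (2 u)
          have "{d, w, u} \<union> children V u \<subseteq> V \<inter> below d"
            using d(1) children_below[OF w, of d] children_below[OF 2(1), of d]
              children_below[of _ V u d] by auto
          moreover have "card ({d, w, u} \<union> children V u) = 3 + card (children V u)"
            using child_rank[OF V w] child_rank[OF V 2(1)] child_rank[OF V, of d u]
              child_rank[OF V, of w u] child_rank[OF V, of u u] finite_children[OF V, of u]
            by (subst card_Un_disjoint) (auto simp: card_insert_if)
          ultimately show ?thesis
            using 2 card_mono[of "V \<inter> below d" "{d, w, u} \<union> children V u"] fin by simp
        qed
      qed
      define V1 where "V1 = V - below d"
      have V1: "rooted V1" "finite V1" "V1 \<subseteq> V"
        using rooted_prune[OF V False] fin by (auto simp: V1_def)
      have card: "card V = card V1 + card (V \<inter> below d)"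
        using fin card_Diff_subset_Int[of V "below d"] card_mono[OF fin, of "V \<inter> below d"]
        by (simp add: V1_def)
      have pd: "par d \<in> V1"
        using par_not_below[OF V d(1) False] rooted_par[OF V d(1) False] by (simp add: V1_def)
      show ?thesis
      proof (cases "k + 2 \<le> card V1")
        case True
        obtain D where D: "isolates edges k V1 D" "(k + 2) * card D \<le> card V1"
          using less.hyps[OF _ V1(1) True] card sub by auto
        have "isolates edges k V (insert d D)"
        proof (rule isolates_insert[OF fin V1(3) d(1) D(1)])
          fix x y assume "x \<in> V1" "y \<in> V - V1" "(x, y) \<in> edges"
          then have "y = d"
            using below_cross[of x d y] by (auto simp: V1_def)
          then show "x \<in> dominated edges {d} \<or> y \<in> dominated edges {d}"
            by (simp add: dominated_def)
        qed (use loc in \<open>auto simp: V1_def\<close>)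
        moreover have "card (insert d D) \<le> Suc (card D)"
          by (cases "finite D") (simp_all add: card_insert_if)
        then have "(k + 2) * card (insert d D) \<le> (k + 2) * Suc (card D)"
          by (rule mult_le_mono2)
        then have "(k + 2) * card (insert d D) \<le> card V"
          using D(2) card sub by simp
        ultimately show ?thesis by blast
      next
        case small: False
        \<comment> \<open>\<open>par d\<close> is dominated by \<open>d\<close>, which leaves at most \<open>k\<close> vertices outside the branch.\<close>
        define V2 where "V2 = V1 - {par d}"
        have V2: "finite V2" "V2 \<subseteq> V" "card V2 \<le> k"
          using V1 pd small by (auto simp: V2_def)
        have "isolates edges k V {d}"
        proof (rule isolates_insert[OF fin V2(2) d(1)])
          show "isolates edges k V2 {}"
            using V2 irrefl_edges[OF V] by (intro isolates_small) auto
        next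
          fix x assume x: "x \<in> V - V2 - dominated edges {d}"
          then have "x \<noteq> par d"
            using False by (auto simp: dominated_def edges_def)
          then show "card (edges `` {x} \<inter> (V - dominated edges {d})) < k"
            using x loc by (auto simp: V2_def V1_def)
        next
          fix x y assume xy: "x \<in> V2" "y \<in> V - V2" "(x, y) \<in> edges"
          then have "y = d \<or> y = par d"
            using below_cross[of x d y] by (auto simp: V2_def V1_def)
          then show "x \<in> dominated edges {d} \<or> y \<in> dominated edges {d}"
            using False by (auto simp: dominated_def edges_def)
        qed
        then show ?thesis
          using less.prems(2) by (intro exI[of _ "{d}"]) simp
      qed
    qed
  qed
  then show thesis using that by blast
qed

end

section \<open>The bound by order and leaf order\<close>

context parent_map
begin

lemma childless_below_nonempty:
  assumes "rooted V" "d \<in> V"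
  obtains c where "c \<in> childless V \<inter> below d"
proof -
  have fin: "finite (V \<inter> below d)" "V \<inter> below d \<noteq> {}"
    using assms rooted_finite by auto
  then have "Max (rank ` (V \<inter> below d)) \<in> rank ` (V \<inter> below d)"
    by (intro Max_in) auto
  then obtain c where c: "c \<in> V \<inter> below d" "rank c = Max (rank ` (V \<inter> below d))"
    by auto
  have "children V c = {}"
  proof (rule ccontr)
    assume "children V c \<noteq> {}"
    then obtain w where w: "w \<in> children V c" by blast
    then have "rank w \<le> rank c"
      using c fin children_below[OF w, of d] by simp
    then show False
      using child_rank[OF assms(1) w] by simp
  qed
  then show thesis
    using that[of c] c by (simp add: childless_def)
qed

text \<open>
  The branches at the children of \<open>d\<close> are disjoint, and each contains a childless vertex.
\<close>

lemma card_children_le_childless: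
  assumes "rooted V" "d \<in> V"
  shows "card (children V d) \<le> card (childless V \<inter> below d)"
proof -
  have "\<exists>c. c \<in> childless V \<inter> below w" if "w \<in> children V d" for w
    by (rule childless_below_nonempty[OF assms(1), of w]) (use childrenD[OF that] in auto)
  then obtain c where c: "\<And>w. w \<in> children V d \<Longrightarrow> c w \<in> childless V \<inter> below w"
    by metis
  have disj: "w = w'" if w: "w \<in> children V d" "w' \<in> children V d" and x: "w \<in> below w'" for w w'
  proof (rule ccontr)
    assume "w \<noteq> w'"
    then have "d \<in> below w'"
      using below_cases[OF x] w by (auto simp: children_def)
    then show False
      using below_rank[OF assms] child_rank[OF assms(1) w(2)] by fastforce
  qed
  have "inj_on c (children V d)"
  proof (rule inj_onI)
    fix w w' assume w: "w \<in> children V d" "w' \<in> children V d" "c w = c w'"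
    then show "w = w'"
      using below_comparable[of "c w" w w'] c[of w] c[of w'] disj[of w w'] disj[of w' w] by auto
  qed
  moreover have "c ` children V d \<subseteq> childless V \<inter> below d"
  proof
    fix x assume "x \<in> c ` children V d"
    then obtain w where w: "w \<in> children V d" "x = c w" by blast
    then show "x \<in> childless V \<inter> below d"
      using c[OF w(1)] children_below[OF w(1), of d] below_trans[of x w d] by auto
  qed
  moreover have "finite (childless V \<inter> below d)"
    using rooted_finite[OF assms(1)] by (simp add: childless_def)
  ultimately show ?thesis
    by (rule card_inj_on_le)
qed

lemma card_childless_below_ge:
  assumes "rooted V" "d \<in> V"
  shows "max 1 (card (children V d)) \<le> card (childless V \<inter> below d)"
proof -
  have "finite (childless V \<inter> below d)"
    using rooted_finite[OF assms(1)] by (simp add: childless_def)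
  moreover obtain x where "x \<in> childless V \<inter> below d"
    by (rule childless_below_nonempty[OF assms])
  ultimately have "0 < card (childless V \<inter> below d)"
    unfolding card_gt_0_iff by blast
  then show ?thesis
    using card_children_le_childless[OF assms] by simp
qed

text \<open>
  In a tree rooted at a leaf, \<open>card (childless V) + 1\<close> is the number of leaves, so \<open>c\<close> times the size of
  the isolating set is bounded by order plus leaf order. The constant \<open>c = k + 1 + max k 2\<close> is the
  smallest value of order plus leaf order of a tree that has a vertex of degree \<open>k\<close>; it is \<open>4\<close> for
  \<open>k = 1\<close>, since a single edge has two leaves, and \<open>2 * k + 1\<close> for \<open>k \<ge> 2\<close>.

  Again a lowest bad branch is cut off. Its vertices and childless vertices together number at least
  \<open>c\<close>, but cutting it off may create a new childless vertex, namely \<open>par d\<close> if \<open>d\<close> was its only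
  child. In that case \<open>par d\<close> is cut off as well, which \<open>d\<close> dominates anyway: the additional removed
  vertex pays for the one new childless vertex that this can create.
\<close>

theorem isolating_set_of_childless:
  fixes k :: nat
  defines "c \<equiv> k + 1 + max k 2"
  assumes "rooted V" "1 \<le> k"
  obtains D where "isolates edges k V D" "c * card D \<le> card V + card (childless V) + 1"
proof -
  have "\<exists>D. isolates edges k V D \<and> c * card D \<le> card V + card (childless V) + 1"
    using assms(2)
  proof (induction "card V" arbitrary: V rule: less_induct)
    case less
    note V = less.prems and fin = rooted_finite[OF less.prems]
    have fin_cl: "finite (childless V)"
      using fin by (simp add: childless_def)
    \<comment> \<open>For \<open>k = 1\<close> the first alternative must be excluded: a vertex with a single childless child has
        a branch whose numbers of vertices and of childless vertices add up to three, one less than \<open>c = 4\<close>.\<close>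
    define bad where "bad d \<longleftrightarrow> 2 \<le> k \<and> k \<le> card (children V d) \<or>
        (\<exists>w\<in>children V d. \<exists>u\<in>children V w. k \<le> card (children V u) + 1)" for d
    obtain d where d: "d \<in> V" "d = r \<or> bad d" "\<forall>e\<in>V \<inter> below d - {d}. \<not> bad e"
      using lowest_vertex[OF V, of bad] by auto
    have loc: "card (edges `` {x} \<inter> (V - dominated edges {d})) < k"
      if x: "x \<in> V \<inter> below d - dominated edges {d}" for x
    proof (rule isolated_below[OF V d(1) _ _ x])
      fix e w u assume e: "e \<in> V \<inter> below d - {d}" and wu: "w \<in> children V e" "u \<in> children V w"
      have "\<not> bad e"
        using d(3) e by blast
      with wu show "card (children V u) + 1 < k"
        unfolding bad_def by (simp add: not_le)
    next
      fix e w assume e: "e \<in> V \<inter> below d - {d}" and w: "w \<in> children V e"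
      have "w \<in> V \<inter> below d - {d}"
        using e children_below[OF w, of d] child_rank[OF V w] below_rank[OF V, of e d] by auto
      then have "\<not> bad w" "\<not> bad e"
        using d(3) e by auto
      show "card (children V w) < k"
      proof (cases "2 \<le> k")
        case False
        then have "k = 1" using assms(3) by simp
        then have "children V w = {}"
          using \<open>\<not> bad e\<close> w unfolding bad_def by force
        then show ?thesis using assms(3) by simp
      qed (use \<open>\<not> bad w\<close> in \<open>auto simp: bad_def\<close>)
    qed
    show ?case
    proof (cases "d = r")
      case True
      show ?thesis
      proof (cases "isolates edges k V {}")
        case True
        then show ?thesis by (intro exI[of _ "{}"]) simp
      next
        case False
        \<comment> \<open>A vertex of degree \<open>k\<close> makes the whole tree large enough to pay for the vertex \<open>d\<close>.\<close>
        then obtain x where x: "x \<in> V" "k \<le> card (edges `` {x} \<inter> V)"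
          by (auto simp: isolates_def dominated_def not_less)
        have "edges `` {x} \<inter> V \<subseteq> V - {x}"
          using irrefl_edges[OF V x(1)] by auto
        then have "card (edges `` {x} \<inter> V) \<le> card V - 1"
          using fin x(1) by (metis card_Diff_singleton card_mono finite_Diff)
        moreover have "card V \<noteq> 0"
          using fin x by auto
        ultimately have n: "k + 1 \<le> card V"
          using x by linarith
        have "card (edges `` {x} \<inter> V) \<le> card (insert (par x) (children V x))"
          using finite_children[OF V] by (intro card_mono) (auto simp: edges_def children_def)
        also have "\<dots> \<le> card (children V x) + 1"
          using finite_children[OF V] by (simp add: card_insert_if)
        finally have "k \<le> card (children V x) + 1"
          using x(2) by linarith
        moreover have "card (childless V \<inter> below x) \<le> card (childless V)"
          using fin_cl by (simp add: card_mono)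
        ultimately have "max k 2 \<le> card (childless V) + 1"
          using card_childless_below_ge[OF V x(1)] by linarith
        then have "c \<le> card V + card (childless V) + 1"
          using n unfolding c_def by linarith
        moreover have "isolates edges k V {d}"
          using loc d(1) all_below_root[OF V] \<open>d = r\<close> by (auto simp: isolates_def)
        ultimately show ?thesis
          by (intro exI[of _ "{d}"]) simp
      qed
    next
      case False
      have sub: "c \<le> card (V \<inter> below d) + card (childless V \<inter> below d)"
      proof -
        from d(2) False consider "2 \<le> k" "k \<le> card (children V d)"
          | w u where "w \<in> children V d" "u \<in> children V w" "k \<le> card (children V u) + 1"
          by (auto simp: bad_def)
        then show ?thesis
        proof cases
          case 1
          have "insert d (children V d) \<subseteq> V \<inter> below d"
            using d(1) children_below[of _ V d d] by auto
          moreover have "card (insert d (children V d)) = 1 + card (children V d)"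
            using child_rank[OF V, of d d] finite_children[OF V, of d] by (auto simp: card_insert_if)
          ultimately have "1 + card (children V d) \<le> card (V \<inter> below d)"
            using card_mono[of "V \<inter> below d" "insert d (children V d)"] fin by simp
          then show ?thesis
            using 1 card_childless_below_ge[OF V d(1)] unfolding c_def by linarith
        next
          case (2 w u)
          have wu: "w \<in> V \<inter> below d" "u \<in> V \<inter> below d"
            using children_below[OF 2(1), of d] children_below[OF 2(2), of d] by auto
          have "{d, w, u} \<union> children V u \<subseteq> V \<inter> below d"
            using d(1) wu children_below[of _ V u d] by auto
          moreover have "card ({d, w, u} \<union> children V u) = 3 + card (children V u)"
            using child_rank[OF V 2(1)] child_rank[OF V 2(2)] child_rank[OF V, of d u]
              child_rank[OF V, of w u] child_rank[OF V, of u u] finite_children[OF V, of u]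
            by (subst card_Un_disjoint) (auto simp: card_insert_if)
          ultimately have "3 + card (children V u) \<le> card (V \<inter> below d)"
            using card_mono[of "V \<inter> below d" "{d, w, u} \<union> children V u"] fin by simp
          moreover have "childless V \<inter> below u \<subseteq> childless V \<inter> below d"
            using wu below_trans[of _ u d] by auto
          then have "card (childless V \<inter> below u) \<le> card (childless V \<inter> below d)"
            using fin_cl by (simp add: card_mono)
          moreover have "max 1 (card (children V u)) \<le> card (childless V \<inter> below u)"
            using card_childless_below_ge[OF V, of u] wu by blast
          ultimately show ?thesis
            using 2(3) unfolding c_def by linarith
        qed
      qed
      have pd: "par d \<in> V" "par d \<notin> below d"
        using par_not_below[OF V d(1) False] rooted_par[OF V d(1) False] by auto
      have dch: "d \<in> children V (par d)"
        using d(1) False by (simp add: children_def)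
      \<comment> \<open>The recursive step, for the branch at \<open>d\<close> and for the one at its parent.\<close>
      have step: ?thesis
        if "q \<noteq> r" "q \<in> V" "V \<inter> below q \<subseteq> insert (par d) (below d)"
          and q: "q = d \<or> q = par d"
          and gain: "card (V \<inter> below d) + card (childless V \<inter> below d) + card (childless (V - below q))
                \<le> card (V \<inter> below q) + card (childless V)" for q
      proof -
        define V1 where "V1 = V - below q"
        have V1: "rooted V1" "V1 \<subseteq> V"
          using rooted_prune[OF V that(1)] by (auto simp: V1_def)
        have card: "card V = card V1 + card (V \<inter> below q)"
          using fin card_Diff_subset_Int[of V "below q"] card_mono[OF fin, of "V \<inter> below q"]
          by (simp add: V1_def)
        have "card (V \<inter> below q) \<noteq> 0"
          using that(2) fin by auto
        then obtain D where D: "isolates edges k V1 D" "c * card D \<le> card V1 + card (childless V1) + 1"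
          using less.hyps[OF _ V1(1)] card by auto
        have "isolates edges k V (insert d D)"
        proof (rule isolates_insert[OF fin V1(2) d(1) D(1)])
          fix x assume x: "x \<in> V - V1 - dominated edges {d}"
          then have "x \<noteq> par d"
            using False by (auto simp: dominated_def edges_def)
          then show "card (edges `` {x} \<inter> (V - dominated edges {d})) < k"
            using x loc that(3) by (auto simp: V1_def)
        next
          fix x y assume "x \<in> V1" "y \<in> V - V1" "(x, y) \<in> edges"
          then have "y = d \<or> y = par d"
            using below_cross[of x q y] q by (auto simp: V1_def)
          then show "x \<in> dominated edges {d} \<or> y \<in> dominated edges {d}"
            using False by (auto simp: dominated_def edges_def)
        qed
        moreover have "card (insert d D) \<le> Suc (card D)"
          by (cases "finite D") (simp_all add: card_insert_if)
        then have "c * card (insert d D) \<le> c * Suc (card D)"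
          by (rule mult_le_mono2)
        then have "c * card (insert d D) \<le> card V + card (childless V) + 1"
          using D(2) card sub gain by (simp add: V1_def)
        ultimately show ?thesis by blast
      qed
      have cl_split: "card (childless V - below d) + card (childless V \<inter> below d) = card (childless V)"
        using fin_cl by (metis card_Int_Diff add.commute)
      show ?thesis
      proof (cases "children V (par d) = {d}")
        case other: False
        then obtain d' where d': "d' \<in> children V (par d)" "d' \<noteq> d"
          using dch by blast
        then have "d' \<notin> below d"
          using below_cases[of d' d] pd(2) by (auto simp: children_def)
        have "childless (V - below d) \<subseteq> childless V - below d"
        proof
          fix v assume v: "v \<in> childless (V - below d)"
          have "w \<notin> children V v" for w
          proof
            assume w: "w \<in> children V v"
            then have "w \<in> below d"
              using v by (auto simp: childless_def children_def)
            then have "v = par d"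
              using v w below_cases[of w d] by (auto simp: childless_def children_def)
            then have "d' \<in> children (V - below d) v"
              using d' \<open>d' \<notin> below d\<close> by (simp add: children_def)
            then show False
              using v by (simp add: childless_def)
          qed
          then show "v \<in> childless V - below d"
            using v by (auto simp: childless_def)
        qed
        then have "card (childless (V - below d)) \<le> card (childless V - below d)"
          using fin_cl by (simp add: card_mono)
        then show ?thesis
          using step[of d] False d(1) cl_split by auto
      next
        case only: True
        have below_pd: "V \<inter> below (par d) = insert (par d) (V \<inter> below d)"
        proof -
          have "x \<in> below (par d) \<Longrightarrow> x \<in> V \<Longrightarrow> x = par d \<or> x \<in> below d" for x
            unfolding below_def mem_Collect_eq
          proof (induction rule: converse_rtrancl_induct)
            case (step x y)
            then have y: "y = par x" "x \<noteq> r" by auto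
            then have "y = par d \<or> y \<in> below d"
              using step rooted_par[OF V step.prems] by (simp add: below_def)
            then show ?case
            proof
              assume "y = par d"
              then have "x \<in> children V (par d)"
                using y step.prems by (simp add: children_def)
              then show ?thesis using only by (simp add: below_def)
            qed (use y below_child[of x d] in \<open>simp add: below_def\<close>)
          qed simp
          moreover have "d \<in> below (par d)"
            using below_child[OF False below_refl] .
          then have "below d \<subseteq> below (par d)"
            using below_trans by blast
          ultimately show ?thesis
            using pd(1) by auto
        qed
        show ?thesis
        proof (cases "par d = r")
          case True
          then have "V \<subseteq> below (par d)"
            using all_below_root[OF V] by auto
          then have V_sub: "V \<subseteq> insert (par d) (below d)"
            using below_pd by blast
          have "par d \<in> dominated edges {d}"
            using False by (auto simp: dominated_def edges_def)
          then have "x \<in> V \<inter> below d - dominated edges {d}" if "x \<in> V - dominated edges {d}" for x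
            using V_sub that by auto
          then have "isolates edges k V {d}"
            using loc d(1) by (simp add: isolates_def)
          moreover have "card (V \<inter> below d) \<le> card V" "card (childless V \<inter> below d) \<le> card (childless V)"
            using fin fin_cl by (auto intro: card_mono)
          ultimately show ?thesis
            using sub by (intro exI[of _ "{d}"]) simp
        next
          case not_root: False
          define p where "p = par (par d)"
          have "childless (V - below (par d)) \<subseteq> insert p (childless V - below d)"
          proof
            fix v assume v: "v \<in> childless (V - below (par d))"
            have "children V v = {}" if "v \<noteq> p"
            proof (rule ccontr)
              assume "children V v \<noteq> {}"
              then obtain w where w: "w \<in> children V v" by blast
              then have "w \<in> below (par d)"
                using v by (auto simp: childless_def children_def)
              then have "v = p"
                using v w below_cases[of w "par d"] by (auto simp: childless_def children_def p_def)
              then show False using that by simp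
            qed
            then show "v \<in> insert p (childless V - below d)"
              using v below_pd by (auto simp: childless_def)
          qed
          then have "card (childless (V - below (par d))) \<le> card (insert p (childless V - below d))"
            using fin_cl by (intro card_mono) auto
          also have "\<dots> \<le> card (childless V - below d) + 1"
            using fin_cl by (simp add: card_insert_if)
          finally have "card (childless (V - below (par d))) \<le> card (childless V - below d) + 1" .
          moreover have "card (V \<inter> below (par d)) = card (V \<inter> below d) + 1"
            using below_pd pd fin by simp
          ultimately show ?thesis
            using step[of "par d"] not_root pd(1) cl_split below_pd by auto
        qed
      qed
    qed
  qed
  then show thesis using that by blast
qed

end

section \<open>Trees as graphs\<close>

lemma closed_nbhd_dominated: "closed_nbhd G D = dominated (arcs_ends G) D"
  by (auto simp: closed_nbhd_def dominated_def)

lemma arcs_ends_induce_subgraph: "arcs_ends (G \<restriction> W) = arcs_ends G \<inter> W \<times> W"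
  by (auto simp: arcs_ends_conv)

lemma isolating_set_iff:
  assumes "graph G"
  shows "isolating_set k G D \<longleftrightarrow> isolates (arcs_ends G) k (verts G) D"
proof -
  interpret graph G by fact
  define W where "W = verts G - dominated (arcs_ends G) D"
  have *: "(\<exists>H. subgraph H (G \<restriction> W) \<and> K\<^bsub>1,k\<^esub> H) \<longleftrightarrow> (\<exists>x\<in>W. k \<le> card (arcs_ends G `` {x} \<inter> W))"
  proof
    assume "\<exists>H. subgraph H (G \<restriction> W) \<and> K\<^bsub>1,k\<^esub> H"
    then obtain H where H: "subgraph H (G \<restriction> W)" "K\<^bsub>1,k\<^esub> H" by blast
    then obtain U V where UV: "verts H = U \<union> V" "card U = 1" "card V = k"
        "arcs_ends H = U \<times> V \<union> V \<times> U"
      by (auto simp: complete_bipartite_digraph_def)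
    then obtain x where x: "U = {x}"
      by (auto simp: card_1_singleton_iff)
    have "arcs_ends H \<subseteq> arcs_ends (G \<restriction> W)" "verts H \<subseteq> W"
      using H(1) arcs_ends_mono[OF H(1)] by (auto simp: subgraph_def)
    then have "V \<subseteq> arcs_ends G `` {x} \<inter> W" "x \<in> W"
      using UV x by (auto simp: arcs_ends_induce_subgraph)
    then show "\<exists>x\<in>W. k \<le> card (arcs_ends G `` {x} \<inter> W)"
      using UV(3) card_mono[of "arcs_ends G `` {x} \<inter> W" V] finite_verts by (auto simp: W_def)
  next
    assume "\<exists>x\<in>W. k \<le> card (arcs_ends G `` {x} \<inter> W)"
    then obtain x where x: "x \<in> W" "k \<le> card (arcs_ends G `` {x} \<inter> W)" by blast
    then obtain S where S: "S \<subseteq> arcs_ends G `` {x} \<inter> W" "card S = k"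
      by (metis obtain_subset_with_card_n)
    have xS: "x \<notin> S"
      using S adj_not_same by auto
    define H where "H = \<lparr> verts = insert x S,
        arcs = {a \<in> arcs G. tail G a = x \<and> head G a \<in> S \<or> head G a = x \<and> tail G a \<in> S},
        tail = tail G, head = head G \<rparr>"
    have ends: "arcs_ends H = {x} \<times> S \<union> S \<times> {x}"
    proof -
      have "arcs_ends H = arcs_ends G \<inter> ({x} \<times> S \<union> S \<times> {x})"
        by (auto simp: arcs_ends_conv H_def)
      moreover have "{x} \<times> S \<union> S \<times> {x} \<subseteq> arcs_ends G"
        using S graph_symmetric by auto
      ultimately show ?thesis by blast
    qed
    have SW: "S \<subseteq> W" "W \<subseteq> verts G" using S by (auto simp: W_def)
    have "graph H"
    proof
      show "symmetric H"
        unfolding symmetric_def ends by (auto simp: sym_def)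
    qed (use xS finite_subset[OF _ finite_verts, of S] SW no_multi_arcs in
          \<open>auto simp: H_def arc_to_ends_def\<close>)
    moreover have "subgraph H (G \<restriction> W)"
      unfolding subgraph_def
    proof (intro conjI)
      show "wf_digraph H"
        using \<open>graph H\<close> by (simp add: graph_def digraph_def fin_digraph_def)
      show "wf_digraph (G \<restriction> W)"
        by (rule wellformed_induce_subgraph)
    qed (use x(1) SW in \<open>auto simp: H_def compatible_def\<close>)
    moreover have "K\<^bsub>1,k\<^esub> H"
      unfolding complete_bipartite_digraph_def
    proof (intro conjI exI)
      show "verts H = {x} \<union> S" "{x} \<inter> S = {}" "card {x} = 1"
        using xS by (auto simp: H_def)
    qed (use S(2) ends \<open>graph H\<close> in auto)
    ultimately show "\<exists>H. subgraph H (G \<restriction> W) \<and> K\<^bsub>1,k\<^esub> H" by blast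
  qed
  then show ?thesis
    unfolding isolating_set_def isolates_def closed_nbhd_dominated W_def[symmetric] *
    by (auto simp: not_le)
qed

lemma isolation_number_le:
  assumes "graph G" "isolates (arcs_ends G) k (verts G) D"
  shows "isolation_number k G \<le> card D"
  unfolding isolation_number_def
  using assms isolating_set_iff by (intro Least_le) blast

lemma isolation_number_ge:
  assumes "graph G"
    and "\<And>D. isolates (arcs_ends G) k (verts G) D \<Longrightarrow> m \<le> card D"
  shows "m \<le> isolation_number k G"
proof -
  have "isolates (arcs_ends G) k (verts G) (verts G)"
    by (auto simp: isolates_def dominated_def)
  then have "\<exists>m D. isolating_set k G D \<and> card D = m"
    using assms(1) isolating_set_iff by blast
  then have "\<exists>D. isolating_set k G D \<and> card D = isolation_number k G"
    unfolding isolation_number_def by (rule LeastI_ex)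
  then show ?thesis
    using assms isolating_set_iff by metis
qed

lemma (in graph) out_degree_card: "out_degree G v = card (arcs_ends G `` {v})"
proof -
  have "bij_betw (head G) (out_arcs G v) (arcs_ends G `` {v})"
    unfolding bij_betw_def
  proof
    show "inj_on (head G) (out_arcs G v)"
      using no_multi_arcs by (auto simp: inj_on_def arc_to_ends_def)
  qed (force simp: arcs_ends_conv)
  then show ?thesis
    unfolding out_degree_def by (rule bij_betw_same_card)
qed

lemma (in wf_digraph) cycle_through_vertex:
  assumes p: "apath x p x'" and "x \<noteq> x'" "y \<notin> set (awalk_verts x p)"
    and "(y, x) \<in> arcs_ends G" "(x', y) \<in> arcs_ends G"
  shows "\<exists>q. cycle q \<and> 3 \<le> length q"
proof -
  obtain e1 e2 where e: "e1 \<in> arcs G" "tail G e1 = y" "head G e1 = x"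
      "e2 \<in> arcs G" "tail G e2 = x'" "head G e2 = y"
    using assms(4,5) by (auto simp: arcs_ends_conv)
  have walk: "awalk x p x'" "distinct (awalk_verts x p)"
    using p by (auto simp: apath_def)
  then have walk2: "awalk x (p @ [e2]) y"
    using awalk_appendI[OF walk(1), of "[e2]" y] arc_implies_awalk[OF e(4)] e(5,6) by metis
  then have "awalk y (e1 # p @ [e2]) y"
    using e by (simp only: awalk_Cons_iff)
  moreover have "awalk_verts x (p @ [e2]) = awalk_verts x p @ [y]"
    using awalk_verts_append[OF walk2] walk(1) e by simp
  then have "distinct (tl (awalk_verts y (e1 # p @ [e2])))"
    using e walk(2) assms(3) by simp
  moreover have "p \<noteq> []"
    using walk(1) assms(2) by (auto simp: awalk_Nil_iff)
  ultimately show ?thesis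
    unfolding cycle_def by (intro exI[of _ "e1 # p @ [e2]"]) (auto simp: Suc_le_eq)
qed

lemma (in parent_map) rooted_reachable:
  assumes "rooted W" "wf_digraph H" "W \<subseteq> verts H" "edges \<inter> W \<times> W \<subseteq> arcs_ends H" "w \<in> W"
  shows "w \<rightarrow>\<^sup>*\<^bsub>H\<^esub> r"
  using assms(5)
proof (induction w rule: measure_induct_rule[of rank])
  case (less w)
  interpret H: wf_digraph H by fact
  show ?case
  proof (cases "w = r")
    case False
    have pw: "par w \<in> W" "rank (par w) < rank w"
      using rooted_par[OF assms(1) less.prems False] rooted_rank[OF assms(1) less.prems False] by auto
    then have "(w, par w) \<in> edges \<inter> W \<times> W"
      using False less.prems by (auto simp: edges_def)
    then have "w \<rightarrow>\<^bsub>H\<^esub> par w"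
      using assms(4) by blast
    then show ?thesis
      using less.IH[OF pw(2,1)] by (rule H.adj_reachable_trans)
  next
    case True
    then show ?thesis
      using less.prems assms(3) by (simp add: subset_iff)
  qed
qed

text \<open>
  Two neighbours of \<open>y\<close> in the rooted part would be joined by a path there, which closes up to a cycle
  through \<open>y\<close>.
\<close>

lemma (in graph) unique_neighbour_in_rooted:
  assumes acyclic: "\<not> (\<exists>p. cycle p \<and> 3 \<le> length p)"
    and W: "W \<subseteq> verts G" "parent_map.rooted r par rank W"
    and edges: "arcs_ends G \<inter> W \<times> W = parent_map.edges r par \<inter> W \<times> W"
    and y: "y \<notin> W"
    and x: "x \<in> W" "(x, y) \<in> arcs_ends G" and x': "x' \<in> W" "(x', y) \<in> arcs_ends G"
  shows "x = x'"
proof (rule ccontr)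
  assume "x \<noteq> x'"
  interpret parent_map r par rank .
  interpret GW: wf_digraph "G \<restriction> W"
    using wellformed_induce_subgraph .
  have sym: "symmetric (G \<restriction> W)"
    using sym_arcs by (auto simp: symmetric_def arcs_ends_induce_subgraph sym_def)
  have reach: "w \<rightarrow>\<^sup>*\<^bsub>G \<restriction> W\<^esub> r" if "w \<in> W" for w
    by (rule rooted_reachable[OF W(2) _ _ _ that])
      (use edges in \<open>auto simp: arcs_ends_induce_subgraph GW.wf_digraph\<close>)
  have "x \<rightarrow>\<^sup>*\<^bsub>G \<restriction> W\<^esub> x'"
    using reach[OF x(1)] symmetric_reachable[OF sym reach[OF x'(1)]] by (rule GW.reachable_trans)
  then obtain p where p: "GW.apath x p x'"
    by (auto simp: GW.reachable_apath)
  have sub: "subgraph (G \<restriction> W) G"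
    using W(1) subgraph_induce_subgraphI by blast
  have ap: "apath x p x'"
    by (rule subgraph_apath_imp_apath[OF p sub])
  have "GW.awalk x p x'"
    using p by (simp only: GW.apath_def)
  then have "set (GW.awalk_verts x p) \<subseteq> verts (G \<restriction> W)"
    by (simp only: GW.awalk_conv)
  moreover have "GW.awalk_verts = awalk_verts"
    by (rule compatible_awalk_verts[OF compatible_induce_subgraph])
  ultimately have "y \<notin> set (awalk_verts x p)"
    using y by auto
  then have "\<exists>q. cycle q \<and> 3 \<le> length q"
    using cycle_through_vertex[OF ap \<open>x \<noteq> x'\<close>] x(2) x'(2) graph_symmetric by blast
  then show False
    using acyclic by blast
qed

text \<open>
  The root can be chosen freely: the leaf bound needs a leaf and the bound by non-leaves a non-leaf as
  root. The rooted structure is grown vertex by vertex from \<open>r\<close>; connectedness supplies a next vertex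
  and acyclicity makes its parent unique.
\<close>

lemma undirected_tree_rooted:
  assumes "undirected_tree G" "r \<in> verts G"
  obtains par rank where "parent_map.rooted r par rank (verts G)"
    "arcs_ends G = parent_map.edges r par \<inter> verts G \<times> verts G"
proof -
  have "graph G" and conn: "Digraph_Component.connected G"
    and acyclic: "\<not> (\<exists>p. pre_digraph.cycle G p \<and> 3 \<le> length p)"
    using assms(1) by (auto simp: undirected_tree_def)
  interpret graph G by fact
  have "\<exists>W par rank. W \<subseteq> verts G \<and> card W = Suc m \<and> parent_map.rooted r par rank W \<and>
      arcs_ends G \<inter> W \<times> W = parent_map.edges r par \<inter> W \<times> W"
    if "m < card (verts G)" for m
    using that
  proof (induction m)
    case 0
    have "parent_map.rooted r id (\<lambda>_. 0 :: nat) {r}"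
      "arcs_ends G \<inter> {r} \<times> {r} = parent_map.edges r id \<inter> {r} \<times> {r}"
      using adj_not_same by (auto simp: parent_map.rooted_def parent_map.edges_def)
    then show ?case
      using assms(2) by (intro exI[of _ "{r}"]) auto
  next
    case (Suc m)
    then obtain W par and rank :: "'a \<Rightarrow> nat" where W: "W \<subseteq> verts G" "card W = Suc m"
        "parent_map.rooted r par rank W"
        "arcs_ends G \<inter> W \<times> W = parent_map.edges r par \<inter> W \<times> W"
      by auto
    have rW: "r \<in> W" and finW: "finite W"
      using W(3) by (auto simp: parent_map.rooted_def)
    obtain z where z: "z \<in> verts G" "z \<notin> W"
      using W(1,2) Suc.prems by (metis card_mono finW not_less subsetI)
    have "r \<rightarrow>\<^sup>*\<^bsub>G\<^esub> z"
      using symmetric_connected_imp_strongly_connected[OF sym_arcs conn] assms(2) z(1) by auto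
    then have "\<exists>x y. x \<in> W \<and> y \<notin> W \<and> (x, y) \<in> arcs_ends G"
      using z(2)
    proof (induction rule: reachable_induct)
      case base
      then show ?case using rW by simp
    next
      case (step x y)
      then show ?case by blast
    qed
    then obtain x y where xy: "x \<in> W" "y \<notin> W" "(x, y) \<in> arcs_ends G" by blast
    have uniq: "x' = x" if "x' \<in> W" "(x', y) \<in> arcs_ends G" for x'
      using unique_neighbour_in_rooted[OF acyclic W(1,3,4) xy(2) that xy(1,3)] .
    have yx: "(y, x) \<in> arcs_ends G"
      using xy(3) by (rule graph_symmetric)
    have yG: "y \<in> verts G" using xy(3) adj_in_verts by blast
    have yr: "y \<noteq> r" using rW xy(2) by auto
    define par' where "par' = par(y := x)"
    define rank' where "rank' = rank(y := Suc (rank x))"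
    have "parent_map.rooted r par' rank' (insert y W)"
      using W(3) xy(1,2) by (auto simp: parent_map.rooted_def par'_def rank'_def)
    moreover have "(u, v) \<in> arcs_ends G \<longleftrightarrow> (u, v) \<in> parent_map.edges r par'"
      if uv: "u \<in> insert y W" "v \<in> insert y W" for u v
    proof -
      consider "u \<in> W" "v \<in> W" | "u = y" "v \<in> W" | "u \<in> W" "v = y" | "u = y" "v = y"
        using uv by blast
      then show ?thesis
      proof cases
        case 1
        then have "(u, v) \<in> arcs_ends G \<longleftrightarrow> (u, v) \<in> parent_map.edges r par"
          using W(4) by blast
        then show ?thesis
          using 1 xy(2) by (auto simp: parent_map.edges_def par'_def)
      next
        case 2
        have "(y, v) \<in> arcs_ends G \<longleftrightarrow> v = x"
          using uniq[of v] 2 graph_symmetric[of y v] yx by blast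
        moreover have "par v \<noteq> y" if "v \<noteq> r"
          using W(3) xy(2) that 2 by (auto simp: parent_map.rooted_def)
        ultimately show ?thesis
          using 2 xy(2) yr by (auto simp: parent_map.edges_def par'_def)
      next
        case 3
        have "(u, y) \<in> arcs_ends G \<longleftrightarrow> u = x"
          using uniq[of u] 3 xy(3) by blast
        moreover have "par u \<noteq> y" if "u \<noteq> r"
          using W(3) xy(2) that 3 by (auto simp: parent_map.rooted_def)
        ultimately show ?thesis
          using 3 xy(2) yr by (auto simp: parent_map.edges_def par'_def)
      next
        case 4
        then show ?thesis
          using adj_not_same[of y] xy by (auto simp: parent_map.edges_def par'_def)
      qed
    qed
    then have "arcs_ends G \<inter> insert y W \<times> insert y W
        = parent_map.edges r par' \<inter> insert y W \<times> insert y W"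
      by auto
    moreover have "card (insert y W) = Suc (Suc m)"
      using W(2) xy(2) finW by simp
    ultimately show ?case
      using W(1) yG by blast
  qed
  moreover have "card (verts G) > 0"
    using assms(2) by (auto simp: card_gt_0_iff)
  ultimately obtain W par and rank :: "'a \<Rightarrow> nat" where W: "W \<subseteq> verts G"
      "card W = Suc (card (verts G) - 1)" "parent_map.rooted r par rank W"
      "arcs_ends G \<inter> W \<times> W = parent_map.edges r par \<inter> W \<times> W"
    by (metis diff_less less_numeral_extra(1))
  then have "W = verts G"
    using \<open>card (verts G) > 0\<close> by (simp add: card_subset_eq)
  moreover have "arcs_ends G \<inter> verts G \<times> verts G = arcs_ends G"
    using adj_in_verts by auto
  ultimately show thesis
    using that W by simp
qed

context parent_map
begin

definition tree_digraph :: "'a set \<Rightarrow> ('a, 'a \<times> 'a) pre_digraph" where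
  "tree_digraph V = \<lparr> verts = V, arcs = edges \<inter> V \<times> V, tail = fst, head = snd \<rparr>"

lemma verts_tree_digraph [simp]: "verts (tree_digraph V) = V"
  by (simp add: tree_digraph_def)

lemma arcs_ends_tree_digraph: "arcs_ends (tree_digraph V) = edges \<inter> V \<times> V"
  by (simp add: tree_digraph_def arcs_ends_conv)

lemma higher_neighbour:
  assumes "rooted V" "x \<in> V" "y \<in> V" "(x, y) \<in> edges" "rank y \<le> rank x"
  shows "y = par x"
  using assms rooted_rank[of V y] by (auto simp: edges_def)

lemma graph_tree_digraph:
  assumes "rooted V"
  shows "graph (tree_digraph V)"
proof
  show "symmetric (tree_digraph V)"
    using sym_edges by (auto simp: symmetric_def arcs_ends_tree_digraph sym_def)
qed (use assms irrefl_edges[OF assms] rooted_finite[OF assms]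
    in \<open>auto simp: tree_digraph_def arc_to_ends_def\<close>)

end

lemma (in pre_digraph) cas_nth:
  assumes "cas u p v" "i < length p"
  shows "tail G (p ! i) = awalk_verts u p ! i \<and> head G (p ! i) = awalk_verts u p ! Suc i"
  using assms
proof (induction p arbitrary: u i)
  case (Cons e es)
  show ?case
  proof (cases i)
    case 0
    then show ?thesis
      using Cons.prems by (cases es) auto
  next
    case (Suc j)
    then show ?thesis
      using Cons by auto
  qed
qed simp

context parent_map
begin

text \<open>
  Both neighbours on a cycle of a vertex of maximal rank must be its parent, so they coincide, which
  leaves only the back-and-forth cycles of length two.
\<close>

lemma acyclic_tree_digraph:
  assumes V: "rooted V"
  shows "\<not> (pre_digraph.cycle (tree_digraph V) p \<and> 3 \<le> length p)"
proof
  assume p: "pre_digraph.cycle (tree_digraph V) p \<and> 3 \<le> length p"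
  interpret G: graph "tree_digraph V"
    using graph_tree_digraph[OF V] .
  obtain u where walk: "G.awalk u p u" and dist: "distinct (tl (G.awalk_verts u p))"
    using p by (auto simp: G.cycle_def)
  define vs where "vs = G.awalk_verts u p"
  define m where "m = length p"
  have m: "3 \<le> m" using p by (simp add: m_def)
  have len: "length vs = Suc m"
    by (simp add: vs_def m_def G.length_awalk_verts)
  have edge: "(vs ! i, vs ! Suc i) \<in> edges \<inter> V \<times> V" if "i < m" for i
  proof -
    have "G.cas u p u" "p ! i \<in> arcs (tree_digraph V)"
      using walk that by (auto simp: G.awalk_def m_def)
    then show ?thesis
      using G.cas_nth[of u p u i] that by (auto simp: m_def vs_def tree_digraph_def)
  qed
  have closed: "vs ! 0 = vs ! m"
  proof -
    have "hd vs = u" "last vs = u"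
      using walk unfolding G.awalk_conv vs_def by blast+
    moreover have "vs \<noteq> []" using len by auto
    ultimately show ?thesis
      using len by (simp add: hd_conv_nth last_conv_nth)
  qed
  \<comment> \<open>The start vertex occurs at both ends of \<open>vs\<close>, hence the index range from \<open>1\<close>.\<close>
  have inj: "vs ! i = vs ! j \<Longrightarrow> i = j" if "1 \<le> i" "i \<le> m" "1 \<le> j" "j \<le> m" for i j
  proof -
    assume "vs ! i = vs ! j"
    then have "tl vs ! (i - 1) = tl vs ! (j - 1)"
      using that len by (simp add: nth_tl)
    then have "i - 1 = j - 1"
      using dist that len by (simp add: nth_eq_iff_index_eq vs_def)
    then show "i = j"
      using that by simp
  qed
  have mem: "vs ! i \<in> V" if "i \<le> m" for i
    using edge[of i] edge[of "i - 1"] that m by (cases "i < m") auto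
  have "Max ((\<lambda>i. rank (vs ! i)) ` {1..m}) \<in> (\<lambda>i. rank (vs ! i)) ` {1..m}"
    using m by (intro Max_in) auto
  then obtain i where i: "1 \<le> i" "i \<le> m"
      and i_max: "rank (vs ! i) = Max ((\<lambda>i. rank (vs ! i)) ` {1..m})"
    by auto
  have max: "rank (vs ! j) \<le> rank (vs ! i)" if "j \<le> m" for j
  proof -
    have "rank (vs ! j) \<le> rank (vs ! i)" if "1 \<le> j" "j \<le> m" for j
      unfolding i_max using that by (intro Max_ge) auto
    then show ?thesis
      using that closed m by (cases "j = 0") auto
  qed
  have pred: "vs ! (i - 1) = par (vs ! i)"
  proof -
    have "(vs ! (i - 1), vs ! Suc (i - 1)) \<in> edges"
      using edge[of "i - 1"] i by auto
    moreover have "Suc (i - 1) = i" "i - 1 \<le> m"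
      using i by auto
    ultimately have "(vs ! i, vs ! (i - 1)) \<in> edges"
      using symD[OF sym_edges] by metis
    then show ?thesis
      using higher_neighbour[OF V mem[OF i(2)] mem[OF \<open>i - 1 \<le> m\<close>]] max[OF \<open>i - 1 \<le> m\<close>] by blast
  qed
  show False
  proof (cases "i < m")
    case True
    then have "vs ! Suc i = par (vs ! i)"
      using higher_neighbour[OF V, of "vs ! i" "vs ! Suc i"] mem[of i] mem[of "Suc i"] max[of "Suc i"]
        edge[of i] by simp
    then have eq: "vs ! (i - 1) = vs ! Suc i"
      using pred by simp
    show False
    proof (cases "i = 1")
      case True
      then have "vs ! m = vs ! 2"
        using eq closed by (simp add: numeral_2_eq_2)
      then show False
        using inj[of m 2] m by simp
    next
      case False
      then have "i - 1 = Suc i"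
        using i True by (intro inj[OF _ _ _ _ eq]) auto
      then show False by simp
    qed
  next
    case False
    then have "i = m" using i by simp
    then have "(vs ! i, vs ! 1) \<in> edges"
      using edge[of 0] m closed by simp
    then have "vs ! 1 = par (vs ! i)"
      using higher_neighbour[OF V, of "vs ! i" "vs ! 1"] mem[of i] mem[of 1] max[of 1] m \<open>i = m\<close> by simp
    then have "vs ! (m - 1) = vs ! 1"
      using pred \<open>i = m\<close> by simp
    then have "m - 1 = 1"
      using m by (intro inj) auto
    then show False using m by simp
  qed
qed

theorem undirected_tree_digraph:
  assumes V: "rooted V"
  shows "undirected_tree (tree_digraph V)"
proof -
  interpret G: graph "tree_digraph V"
    using graph_tree_digraph[OF V] .
  have reach: "v \<rightarrow>\<^sup>*\<^bsub>tree_digraph V\<^esub> r" if "v \<in> V" for v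
    by (rule rooted_reachable[OF V G.wf_digraph _ _ that]) (auto simp: arcs_ends_tree_digraph)
  have "Digraph_Component.connected (tree_digraph V)"
  proof (rule G.connectedI)
    show "verts (tree_digraph V) \<noteq> {}"
      using V by (auto simp: rooted_def)
    fix u v assume "u \<in> verts (tree_digraph V)" "v \<in> verts (tree_digraph V)"
    then have "u \<rightarrow>\<^sup>*\<^bsub>tree_digraph V\<^esub> v"
      using reach[of u] symmetric_reachable[OF G.sym_arcs reach[of v]] G.reachable_trans by simp
    then show "u \<rightarrow>\<^sup>*\<^bsub>with_proj (mk_symmetric (tree_digraph V))\<^esub> v"
      by (rule G.reachable_mk_symmetricI)
  qed
  then show ?thesis
    using acyclic_tree_digraph[OF V] G.graph_axioms by (auto simp: undirected_tree_def)
qed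

lemma neighbours_rooted:
  assumes "rooted V" "v \<in> V"
  shows "edges `` {v} \<inter> V = (if v = r then children V v else insert (par v) (children V v))"
  using assms rooted_par[OF assms] by (auto simp: edges_def children_def)

lemma degree_rooted:
  assumes "rooted V" "v \<in> V"
  shows "card (edges `` {v} \<inter> V) = card (children V v) + (if v = r then 0 else 1)"
proof -
  have "par v \<notin> children V v" if "v \<noteq> r"
    using rooted_rank[OF assms that] child_rank[OF assms(1), of "par v" v] by auto
  then show ?thesis
    using neighbours_rooted[OF assms] finite_children[OF assms(1)] by simp
qed

end

text \<open>
  Rooted at \<open>x\<close>, every other vertex has parent \<open>x\<close>, so there are no edges apart from those at \<open>x\<close>.
\<close>

lemma universal_vertex_imp_star:
  assumes T: "undirected_tree T" and x: "x \<in> verts T" and n: "2 \<le> card (verts T)"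
    and adj: "\<And>y. y \<in> verts T \<Longrightarrow> y \<noteq> x \<Longrightarrow> (x, y) \<in> arcs_ends T"
  shows "is_star T"
proof -
  interpret graph T using T by (simp add: undirected_tree_def)
  obtain par and rank :: "'a \<Rightarrow> nat" where V: "parent_map.rooted x par rank (verts T)"
      and E: "arcs_ends T = parent_map.edges x par \<inter> verts T \<times> verts T"
    using undirected_tree_rooted[OF T x] .
  interpret parent_map x par rank .
  have par: "par y = x" if "y \<in> verts T" "y \<noteq> x" for y
    using adj[OF that] E that by (auto simp: edges_def)
  have "arcs_ends T = {x} \<times> (verts T - {x}) \<union> (verts T - {x}) \<times> {x}"
    unfolding E using par x by (auto simp: edges_def)
  moreover have "verts T = {x} \<union> (verts T - {x})"
    using x by auto
  ultimately have "K\<^bsub>1,card (verts T) - 1\<^esub> T"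
    unfolding complete_bipartite_digraph_def
  proof (intro conjI exI)
    show "card {x} = 1" "{x} \<inter> (verts T - {x}) = {}" "card (verts T - {x}) = card (verts T) - 1"
      using x by simp_all
  qed (rule graph_axioms)
  then show ?thesis
    using n unfolding is_star_def by (intro exI[of _ "card (verts T) - 1"]) auto
qed

section \<open>Upper bounds for trees that are not stars\<close>

locale nonstar_tree = graph T for T :: "('a, 'b) pre_digraph" +
  assumes tree: "undirected_tree T" and nonstar: "\<not> is_star T"
begin

abbreviation "E \<equiv> arcs_ends T"
abbreviation "V \<equiv> verts T"

text \<open>
  Some vertex is not adjacent to \<open>r\<close>, and its parent in the tree rooted at \<open>r\<close> has both a child and a
  parent. Using this twice gives two non-leaves.
\<close>

lemma exists_non_leaf:
  assumes "2 \<le> card V" "r \<in> V"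
  obtains y where "y \<in> V" "y \<noteq> r" "out_degree T y \<noteq> 1"
proof -
  obtain v where v: "v \<in> V" "v \<noteq> r" "(r, v) \<notin> E"
    using universal_vertex_imp_star[OF tree assms(2,1)] nonstar by blast
  obtain par and rank :: "'a \<Rightarrow> nat" where V: "parent_map.rooted r par rank V"
      and E: "E = parent_map.edges r par \<inter> V \<times> V"
    using undirected_tree_rooted[OF tree assms(2)] .
  interpret parent_map r par rank .
  have pv: "par v \<in> V" "par v \<noteq> r"
    using v rooted_par[OF V v(1,2)] E assms(2) by (auto simp: edges_def)
  have "v \<in> children V (par v)"
    using v by (simp add: children_def)
  then have "card (children V (par v)) \<noteq> 0"
    using finite_children[OF V] by auto
  moreover have "E `` {par v} = edges `` {par v} \<inter> V"
    using pv E by auto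
  ultimately have "out_degree T (par v) \<noteq> 1"
    using degree_rooted[OF V pv(1)] pv(2) by (simp add: out_degree_card)
  then show thesis
    using that pv by blast
qed

lemma exists_leaf:
  assumes "2 \<le> card V"
  obtains y where "y \<in> V" "out_degree T y = 1"
proof -
  obtain W where "W \<subseteq> V" "card W = 2"
    using assms by (rule obtain_subset_with_card_n)
  then obtain r v where rv: "r \<in> V" "v \<in> V" "v \<noteq> r"
    by (auto simp: card_2_iff)
  obtain par and rank :: "'a \<Rightarrow> nat" where V: "parent_map.rooted r par rank V"
      and E: "E = parent_map.edges r par \<inter> V \<times> V"
    using undirected_tree_rooted[OF tree rv(1)] .
  interpret parent_map r par rank .
  obtain y where y: "y \<in> childless V \<inter> below v"
    by (rule childless_below_nonempty[OF V rv(2)])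
  then have "y \<in> V" "y \<noteq> r" "children V y = {}"
    using below_root[of v] rv(3) by (auto simp: childless_def)
  moreover have "E `` {y} = edges `` {y} \<inter> V"
    using \<open>y \<in> V\<close> E by auto
  ultimately have "out_degree T y = 1"
    using degree_rooted[OF V \<open>y \<in> V\<close>] by (simp add: out_degree_card)
  then show thesis
    using that \<open>y \<in> V\<close> by blast
qed

lemma leaf_order_le: "leaf_order T \<le> card V"
  by (auto simp: leaf_order_def intro: card_mono)

text \<open>
  The non-leaves form a tree with at least two vertices, which has a dominating set of at most half its
  size. What it leaves undominated are leaves of the original tree, and no two of these are adjacent.
\<close>

lemma isolation_number_le_half_non_leaves:
  assumes "1 \<le> k"
  shows "2 * isolation_number k T + leaf_order T \<le> card V"
proof (cases "2 \<le> card V")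
  case False
  then have "isolates E k V {}"
    using assms adj_not_same by (intro isolates_small) auto
  then have "isolation_number k T = 0"
    using isolation_number_le[OF graph_axioms] by fastforce
  then show ?thesis using leaf_order_le by simp
next
  case True
  then obtain z where "z \<in> V" by fastforce
  then obtain r where r: "r \<in> V" "out_degree T r \<noteq> 1"
    using exists_non_leaf[OF True] by metis
  then obtain y where y: "y \<in> V" "y \<noteq> r" "out_degree T y \<noteq> 1"
    using exists_non_leaf[OF True] by metis
  obtain par and rank :: "'a \<Rightarrow> nat" where V: "parent_map.rooted r par rank V"
      and E: "E = parent_map.edges r par \<inter> V \<times> V"
    using undirected_tree_rooted[OF tree r(1)] .
  interpret parent_map r par rank .
  have deg: "out_degree T v = card (children V v) + (if v = r then 0 else 1)" if "v \<in> V" for v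
  proof -
    have "E `` {v} = edges `` {v} \<inter> V"
      using that E by auto
    then show ?thesis
      using degree_rooted[OF V that] by (simp add: out_degree_card)
  qed
  define I where "I = {v \<in> V. out_degree T v \<noteq> 1}"
  have IV: "I \<subseteq> V" by (auto simp: I_def)
  have par_I: "par v \<in> I" if "v \<in> V" "v \<noteq> r" for v
  proof -
    have "v \<in> children V (par v)"
      using that by (simp add: children_def)
    then have "card (children V (par v)) \<noteq> 0"
      using finite_children[OF V] by auto
    then show ?thesis
      using deg[of "par v"] r(2) rooted_par[OF V that] by (cases "par v = r") (auto simp: I_def)
  qed
  have "rooted I"
    unfolding rooted_def
  proof (intro conjI ballI)
    fix v assume "v \<in> I - {r}"
    then show "par v \<in> I" "rank (par v) < rank v"
      using par_I[of v] rooted_rank[OF V, of v] by (auto simp: I_def)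
  qed (use r in \<open>auto simp: I_def\<close>)
  moreover have "card {r, y} \<le> card I"
    using r y by (intro card_mono) (auto simp: I_def)
  then have "0 + 2 \<le> card I"
    using y(2) by simp
  ultimately obtain D where D: "isolates edges 0 I D" "(0 + 2) * card D \<le> card I"
    using isolating_set_of_order by metis
  then have DI: "D \<subseteq> I" and dom: "I \<subseteq> dominated edges D"
    by (auto simp: isolates_def)
  have "isolates edges k V D"
    unfolding isolates_def
  proof (intro conjI ballI)
    show "D \<subseteq> V" using DI IV by blast
    fix x assume x: "x \<in> V - dominated edges D"
    have "edges `` {x} \<inter> (V - dominated edges D) = {}"
    proof (rule ccontr)
      assume "edges `` {x} \<inter> (V - dominated edges D) \<noteq> {}"
      then obtain w where w: "w \<in> V - dominated edges D" "(x, w) \<in> edges" by blast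
      then have "x \<in> I \<or> w \<in> I"
        using par_I[of x] par_I[of w] x by (auto simp: edges_def)
      then show False
        using x w dom by blast
    qed
    then show "card (edges `` {x} \<inter> (V - dominated edges D)) < k"
      using assms by simp
  qed
  then have "isolates E k V D"
    using isolates_cong[of E V edges k D] E by auto
  then have "isolation_number k T \<le> card D"
    by (rule isolation_number_le[OF graph_axioms])
  moreover have "card I + leaf_order T = card V"
  proof -
    have "I \<union> {v \<in> V. out_degree T v = 1} = V" "I \<inter> {v \<in> V. out_degree T v = 1} = {}"
      by (auto simp: I_def)
    then show ?thesis
      unfolding leaf_order_def by (metis card_Un_disjoint finite_Un finite_verts)
  qed
  ultimately show ?thesis
    using D(2) by simp
qed

text \<open>
  A tree with at most \<open>k + 1\<close> vertices can only have a vertex of degree \<open>k\<close> if it is a star, so it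
  needs no isolating vertex at all.
\<close>

lemma isolation_number_le_order:
  assumes "1 \<le> k"
  shows "(k + 2) * isolation_number k T \<le> card V"
proof (cases "k + 2 \<le> card V")
  case True
  then obtain r where r: "r \<in> V" by fastforce
  obtain par and rank :: "'a \<Rightarrow> nat" where V: "parent_map.rooted r par rank V"
      and E: "E = parent_map.edges r par \<inter> V \<times> V"
    using undirected_tree_rooted[OF tree r(1)] .
  interpret parent_map r par rank .
  obtain D where D: "isolates edges k V D" "(k + 2) * card D \<le> card V"
    by (rule isolating_set_of_order[OF V True])
  have "isolates E k V D"
    using D(1) isolates_cong[of E V edges k D] E by auto
  then have "isolation_number k T \<le> card D"
    by (rule isolation_number_le[OF graph_axioms])
  then have "(k + 2) * isolation_number k T \<le> (k + 2) * card D"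
    by (rule mult_le_mono2)
  then show ?thesis
    using D(2) by linarith
next
  case False
  have "isolates E k V {}"
    unfolding isolates_def
  proof (intro conjI ballI)
    fix x assume x: "x \<in> V - dominated E {}"
    have sub: "E `` {x} \<subseteq> V - {x}"
      using adj_in_verts adj_not_same by auto
    have "E `` {x} \<noteq> V - {x}" if "2 \<le> card V"
      using universal_vertex_imp_star[OF tree _ that, of x] x nonstar by auto
    then have "card (E `` {x}) < k"
    proof (cases "2 \<le> card V")
      case True
      then have "card (E `` {x}) < card (V - {x})"
        using sub \<open>2 \<le> card V \<Longrightarrow> E `` {x} \<noteq> V - {x}\<close> by (intro psubset_card_mono) auto
      then show ?thesis
        using x False by simp
    next
      case single: False
      have "card (E `` {x}) \<le> card (V - {x})"
        using sub by (intro card_mono) auto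
      then show ?thesis
        using x single assms by simp
    qed
    moreover have "E `` {x} \<inter> (V - dominated E {}) = E `` {x}"
      using sub by (auto simp: dominated_def)
    ultimately show "card (E `` {x} \<inter> (V - dominated E {})) < k"
      by simp
  qed simp
  then have "isolation_number k T = 0"
    using isolation_number_le[OF graph_axioms] by fastforce
  then show ?thesis by simp
qed

text \<open>
  Rooting at a leaf makes the leaf order exceed the number of childless vertices by exactly one, the
  root itself.
\<close>

lemma isolation_number_le_order_leaf_order:
  assumes "1 \<le> k"
  shows "(k + 1 + max k 2) * isolation_number k T \<le> card V + leaf_order T"
proof (cases "2 \<le> card V")
  case False
  then have "isolates E k V {}"
    using assms adj_not_same by (intro isolates_small) auto
  then have "isolation_number k T = 0"
    using isolation_number_le[OF graph_axioms] by fastforce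
  then show ?thesis by simp
next
  case True
  obtain r where r: "r \<in> V" "out_degree T r = 1"
    by (rule exists_leaf[OF True])
  obtain par and rank :: "'a \<Rightarrow> nat" where V: "parent_map.rooted r par rank V"
      and E: "E = parent_map.edges r par \<inter> V \<times> V"
    using undirected_tree_rooted[OF tree r(1)] .
  interpret parent_map r par rank .
  have deg: "out_degree T v = card (children V v) + (if v = r then 0 else 1)" if "v \<in> V" for v
  proof -
    have "E `` {v} = edges `` {v} \<inter> V"
      using that E by auto
    then show ?thesis
      using degree_rooted[OF V that] by (simp add: out_degree_card)
  qed
  have "{v \<in> V. out_degree T v = 1} = insert r (childless V)"
    using r deg finite_children[OF V] by (auto simp: childless_def)
  moreover have "r \<notin> childless V"
    using r deg[of r] by (auto simp: childless_def)
  moreover have "finite (childless V)"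
    by (simp add: childless_def)
  ultimately have l: "leaf_order T = card (childless V) + 1"
    by (simp add: leaf_order_def)
  obtain D where D: "isolates edges k V D"
      "(k + 1 + max k 2) * card D \<le> card V + card (childless V) + 1"
    by (rule isolating_set_of_childless[OF V assms])
  have "isolates E k V D"
    using D(1) isolates_cong[of E V edges k D] E by auto
  then have "isolation_number k T \<le> card D"
    by (rule isolation_number_le[OF graph_axioms])
  then have "(k + 1 + max k 2) * isolation_number k T \<le> (k + 1 + max k 2) * card D"
    by (rule mult_le_mono2)
  then show ?thesis
    using D(2) l by linarith
qed

end

section \<open>Caterpillars and lower bounds\<close>

definition star_within :: "('a \<times> 'a) set \<Rightarrow> 'a set \<Rightarrow> ('a \<Rightarrow> nat) \<Rightarrow> nat \<Rightarrow> nat \<times> nat \<Rightarrow> bool" where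
  "star_within E V pos k J \<longleftrightarrow> (\<exists>c\<in>V. \<exists>S\<subseteq>V. pos ` insert c S \<subseteq> {fst J..snd J} \<and>
     S \<subseteq> E `` {c} \<and> k \<le> card S)"

lemma star_withinI:
  assumes "c \<in> V" "a \<le> pos c" "pos c \<le> b" "k \<le> card S"
    and "\<And>v. v \<in> S \<Longrightarrow> v \<in> V \<and> a \<le> pos v \<and> pos v \<le> b \<and> (c, v) \<in> E"
  shows "star_within E V pos k (a, b)"
  unfolding star_within_def
proof (intro bexI exI conjI)
  show "S \<subseteq> V" "S \<subseteq> E `` {c}" using assms(5) by auto
  show "pos ` insert c S \<subseteq> {fst (a, b)..snd (a, b)}"
    using assms(2,3,5) by auto
qed (use assms in auto)

text \<open>
  Every isolating set must meet the closed neighbourhood of each star. If adjacent vertices differ by at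
  most one in position, then stars in intervals at distance at least three need different vertices.
\<close>

lemma card_le_isolating_set:
  fixes pos :: "'a \<Rightarrow> nat"
  assumes iso: "isolates E k V D" and fin: "finite V"
    and near: "\<And>x y. x \<in> V \<Longrightarrow> y \<in> V \<Longrightarrow> (x, y) \<in> E \<Longrightarrow> pos x \<le> pos y + 1 \<and> pos y \<le> pos x + 1"
    and star: "\<And>j. j \<in> J \<Longrightarrow> star_within E V pos k j"
    and apart: "\<And>j j'. j \<in> J \<Longrightarrow> j' \<in> J \<Longrightarrow> j \<noteq> j' \<Longrightarrow> snd j + 3 \<le> fst j' \<or> snd j' + 3 \<le> fst j"
  shows "card J \<le> card D"
proof -
  have DV: "D \<subseteq> V" using iso by (simp add: isolates_def)
  have "\<exists>d\<in>D. fst j \<le> pos d + 1 \<and> pos d \<le> snd j + 1" if j: "j \<in> J" for j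
  proof -
    obtain c S where "c \<in> V" "S \<subseteq> V" and cS: "pos ` insert c S \<subseteq> {fst j..snd j}" "S \<subseteq> E `` {c}" "k \<le> card S"
      using star[OF j] unfolding star_within_def by (elim bexE exE conjE) simp
    then have cSV: "insert c S \<subseteq> V" by simp
    have "insert c S \<inter> dominated E D \<noteq> {}"
    proof
      assume empty: "insert c S \<inter> dominated E D = {}"
      then have "S \<subseteq> E `` {c} \<inter> (V - dominated E D)"
        using cS(2) cSV by blast
      then have "card S \<le> card (E `` {c} \<inter> (V - dominated E D))"
        using fin by (intro card_mono) auto
      moreover have "c \<in> V - dominated E D"
        using empty cSV by blast
      then have "card (E `` {c} \<inter> (V - dominated E D)) < k"
        using iso unfolding isolates_def by blast
      ultimately show False
        using cS(3) by linarith
    qed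
    then obtain z where z: "z \<in> insert c S" "z \<in> dominated E D" by blast
    then have "fst j \<le> pos z" "pos z \<le> snd j" "z \<in> V"
      using cS(1) cSV by auto
    moreover obtain d where "d \<in> D" "d = z \<or> (d, z) \<in> E"
      using z(2) unfolding dominated_def by blast
    moreover from this have "pos d \<le> pos z + 1 \<and> pos z \<le> pos d + 1"
      using near[of d z] DV \<open>z \<in> V\<close> by auto
    ultimately show ?thesis
      by (intro bexI[of _ d]) auto
  qed
  then obtain d where d: "\<And>j. j \<in> J \<Longrightarrow> d j \<in> D \<and> fst j \<le> pos (d j) + 1 \<and> pos (d j) \<le> snd j + 1"
    by metis
  have "inj_on d J"
  proof (rule inj_onI, rule ccontr)
    fix j j' assume j: "j \<in> J" "j' \<in> J" "d j = d j'" "j \<noteq> j'"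
    then have "snd j + 3 \<le> fst j' \<or> snd j' + 3 \<le> fst j"
      by (intro apart)
    then show False
      using d[OF j(1)] d[OF j(2)] j(3) by auto
  qed
  moreover have "d ` J \<subseteq> D"
    using d by blast
  moreover have "finite D"
    using DV fin by (rule finite_subset)
  ultimately show ?thesis
    by (rule card_inj_on_le)
qed

text \<open>
  A spine \<open>0, \<dots>, s - 1\<close> with \<open>p\<close> leaves at its first vertex, \<open>q\<close> leaves at vertex \<open>m\<close> and \<open>t\<close> leaves at
  its last vertex. Leaves at both ends make sure that no spine vertex is itself a leaf.
\<close>

locale caterpillar =
  fixes s p m q t :: nat
  assumes s: "2 \<le> s" and p: "1 \<le> p" and t: "1 \<le> t" and m: "m < s"
begin

text \<open>
  The map that folds each leaf onto its spine vertex. Leaves are numbered from \<open>s\<close> on, in three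
  consecutive blocks; edges change the position by at most one.
\<close>

definition pos :: "nat \<Rightarrow> nat" where
  "pos v = (if v < s then v else if v < s + p then 0 else if v < s + p + q then m else s - 1)"

definition par :: "nat \<Rightarrow> nat" where
  "par v = (if v < s then v - 1 else pos v)"

definition V :: "nat set" where
  "V = {..<s + p + q + t}"

sublocale parent_map 0 par id .

definition T :: "(nat, nat \<times> nat) pre_digraph" where
  "T = tree_digraph V"

lemma pos_less: "pos v < s"
  using s m by (auto simp: pos_def)

lemma rooted_V: "rooted V"
  unfolding rooted_def
proof (intro conjI ballI)
  fix v assume v: "v \<in> V - {0}"
  then have "par v < v"
    using pos_less[of v] by (auto simp: par_def)
  then show "par v \<in> V" "id (par v) < id v"
    using v by (auto simp: V_def)
qed (use s in \<open>auto simp: V_def\<close>)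

lemma undirected_tree_T: "undirected_tree T"
  unfolding T_def by (rule undirected_tree_digraph[OF rooted_V])

lemma verts_T: "verts T = V"
  by (simp add: T_def)

lemma ends_T: "arcs_ends T = edges \<inter> V \<times> V"
  unfolding T_def by (rule arcs_ends_tree_digraph)

lemma card_verts_T: "card (verts T) = s + p + q + t"
  by (simp add: verts_T V_def)

lemma leaf_edge:
  assumes "v \<in> V" "s \<le> v"
  shows "(pos v, v) \<in> arcs_ends T"
proof -
  have "par v = pos v" "v \<noteq> 0" "pos v \<in> V"
    using assms s pos_less[of v] by (simp_all add: par_def V_def)
  then show ?thesis
    using assms(1) by (simp add: ends_T edges_def)
qed

text \<open>
  There are two disjoint edges, one at each end of the spine.
\<close>

lemma not_star_T: "\<not> is_star T"
proof
  assume "is_star T"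
  then obtain U W where UW: "card U = 1" "arcs_ends T = U \<times> W \<union> W \<times> U"
    unfolding is_star_def complete_bipartite_digraph_def by blast
  have "(0, s) \<in> arcs_ends T"
    using leaf_edge[of s] p by (simp add: pos_def V_def)
  moreover have "(s - 1, s + p + q) \<in> arcs_ends T"
    using leaf_edge[of "s + p + q"] t by (simp add: pos_def V_def)
  moreover obtain x where "U = {x}"
    using UW(1) by (auto simp: card_1_singleton_iff)
  then have "x = u \<or> x = v" if "(u, v) \<in> arcs_ends T" for u v
    using that unfolding UW(2) by blast
  ultimately have "x = 0 \<or> x = s" "x = s - 1 \<or> x = s + p + q"
    by blast+
  then show False
    using s p by auto
qed

lemma leaf_order_T: "leaf_order T = p + q + t"
proof -
  interpret G: graph T
    using undirected_tree_T by (simp add: undirected_tree_def)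
  have deg: "out_degree T v = card (children V v) + (if v = 0 then 0 else 1)" if "v \<in> V" for v
  proof -
    have "arcs_ends T `` {v} = edges `` {v} \<inter> V"
      using that ends_T by auto
    then show ?thesis
      using degree_rooted[OF rooted_V that] by (simp add: G.out_degree_card)
  qed
  have fin: "finite (children V v)" for v
    by (rule finite_children[OF rooted_V])
  have child: "s \<in> children V 0" "s + p + q \<in> children V (s - 1)"
    using s p t by (auto simp: children_def V_def par_def pos_def)
  have spine: "v + 1 \<in> children V v" if "v + 1 < s" for v
    using that by (auto simp: children_def V_def par_def)
  have "out_degree T v \<noteq> 1" if "v < s" for v
  proof -
    have v: "v \<in> V" using that by (simp add: V_def)
    show ?thesis
    proof (cases "v = 0")
      case True
      have "card {1, s} \<le> card (children V v)"
        using child(1) spine[of 0] s True fin by (intro card_mono) auto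
      then show ?thesis
        using deg[OF v] s True by simp
    next
      case False
      have "children V v \<noteq> {}"
        using child(2) spine[of v] that by (cases "v + 1 < s") (auto simp: not_less dest: le_antisym)
      then show ?thesis
        using deg[OF v] fin[of v] False by simp
    qed
  qed
  moreover have "out_degree T v = 1" if "v \<in> V" "s \<le> v" for v
  proof -
    have "children V v = {}"
      using that(2) pos_less s by (force simp: children_def par_def dest: leD split: if_splits)
    then show ?thesis
      using deg[OF that(1)] that(2) s by simp
  qed
  ultimately have "{v \<in> V. out_degree T v = 1} = {s..<s + p + q + t}"
    by (force simp: V_def not_less)
  then show ?thesis
    by (simp add: leaf_order_def verts_T)
qed

lemma nonstar_tree_T: "nonstar_tree T"
proof -
  have "graph T"
    using undirected_tree_T by (simp add: undirected_tree_def)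
  then show ?thesis
    using undirected_tree_T not_star_T by (simp add: nonstar_tree_def nonstar_tree_axioms_def)
qed

lemma pos_edge:
  assumes "(x, y) \<in> arcs_ends T"
  shows "pos x \<le> pos y + 1 \<and> pos y \<le> pos x + 1"
proof -
  have spine: "pos w = w" if "w < s" for w
    using that by (simp add: pos_def)
  have near: "pos (par v) \<le> pos v + 1 \<and> pos v \<le> pos (par v) + 1" for v
  proof -
    have "par v < s"
      using pos_less[of v] by (auto simp: par_def)
    then have "pos (par v) = par v"
      by (rule spine)
    then show ?thesis
      using spine[of v] by (auto simp: par_def)
  qed
  obtain v where "x = v \<and> y = par v \<or> x = par v \<and> y = v"
    using assms by (auto simp: ends_T edges_def)
  then show ?thesis
    using near[of v] by auto
qed

lemma isolation_number_ge_intervals: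
  assumes star: "\<And>j. j \<in> J \<Longrightarrow> star_within (arcs_ends T) V pos k j"
    and apart: "\<And>j j'. j \<in> J \<Longrightarrow> j' \<in> J \<Longrightarrow> j \<noteq> j' \<Longrightarrow> snd j + 3 \<le> fst j' \<or> snd j' + 3 \<le> fst j"
  shows "card J \<le> isolation_number k T"
proof (rule isolation_number_ge)
  show "graph T"
    using undirected_tree_T by (simp add: undirected_tree_def)
  fix D assume D: "isolates (arcs_ends T) k (verts T) D"
  show "card J \<le> card D"
  proof (rule card_le_isolating_set[OF D])
    show "finite (verts T)"
      by (simp add: verts_T V_def)
    show "pos x \<le> pos y + 1 \<and> pos y \<le> pos x + 1" if "(x, y) \<in> arcs_ends T" for x y
      by (rule pos_edge[OF that])
    show "star_within (arcs_ends T) (verts T) pos k j" if "j \<in> J" for j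
      unfolding verts_T by (rule star[OF that])
  qed (rule apart)
qed

lemma spine_vertex:
  assumes "v < s"
  shows "v \<in> V \<and> pos v = v"
  using assms by (auto simp: V_def pos_def)

lemma spine_edge:
  assumes "v + 1 < s"
  shows "(v, v + 1) \<in> arcs_ends T" "(v + 1, v) \<in> arcs_ends T"
proof -
  have "par (v + 1) = v" "v \<in> V" "v + 1 \<in> V"
    using assms by (simp_all add: par_def V_def)
  then show "(v, v + 1) \<in> arcs_ends T" "(v + 1, v) \<in> arcs_ends T"
    by (simp_all add: ends_T edges_def)
qed

lemma first_leaf:
  assumes "v \<in> {s..<s + p}"
  shows "v \<in> V \<and> pos v = 0 \<and> (0, v) \<in> arcs_ends T"
  using assms leaf_edge[of v] by (simp add: V_def pos_def)

lemma middle_leaf: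
  assumes "v \<in> {s + p..<s + p + q}"
  shows "v \<in> V \<and> pos v = m \<and> (m, v) \<in> arcs_ends T"
  using assms leaf_edge[of v] by (simp add: V_def pos_def)

lemma last_leaf:
  assumes "v \<in> {s + p + q..<s + p + q + t}"
  shows "v \<in> V \<and> pos v = s - 1 \<and> (s - 1, v) \<in> arcs_ends T"
  using assms leaf_edge[of v] by (simp add: V_def pos_def)

abbreviation "has_star \<equiv> star_within (arcs_ends T) V pos"

lemma star_first: "has_star p (0, 0)"
proof (rule star_withinI[where c = 0 and S = "{s..<s + p}"])
  fix v assume "v \<in> {s..<s + p}"
  then show "v \<in> V \<and> 0 \<le> pos v \<and> pos v \<le> 0 \<and> (0, v) \<in> arcs_ends T"
    using first_leaf[of v] by simp
qed (use spine_vertex[of 0] s in simp_all)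

lemma star_first_spine: "has_star (p + 1) (0, 1)"
proof (rule star_withinI[where c = 0 and S = "insert 1 {s..<s + p}"])
  fix v assume "v \<in> insert 1 {s..<s + p}"
  then show "v \<in> V \<and> 0 \<le> pos v \<and> pos v \<le> 1 \<and> (0, v) \<in> arcs_ends T"
    using first_leaf[of v] spine_vertex[of 1] spine_edge(1)[of 0] s by auto
qed (use spine_vertex[of 0] s in simp_all)

lemma star_last: "has_star t (s - 1, s - 1)"
proof (rule star_withinI[where c = "s - 1" and S = "{s + p + q..<s + p + q + t}"])
  fix v assume "v \<in> {s + p + q..<s + p + q + t}"
  then show "v \<in> V \<and> s - 1 \<le> pos v \<and> pos v \<le> s - 1 \<and> (s - 1, v) \<in> arcs_ends T"
    using last_leaf[of v] by simp
qed (use spine_vertex[of "s - 1"] s in simp_all)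

lemma star_last_spine: "has_star (t + 1) (s - 2, s - 1)"
proof (rule star_withinI[where c = "s - 1" and S = "insert (s - 2) {s + p + q..<s + p + q + t}"])
  have eq: "s - 2 + 1 = s - 1" using s by simp
  have edge: "(s - 1, s - 2) \<in> arcs_ends T"
    using spine_edge(2)[of "s - 2"] s unfolding eq by simp
  fix v assume "v \<in> insert (s - 2) {s + p + q..<s + p + q + t}"
  then consider "v = s - 2" | "v \<in> {s + p + q..<s + p + q + t}" by blast
  then show "v \<in> V \<and> s - 2 \<le> pos v \<and> pos v \<le> s - 1 \<and> (s - 1, v) \<in> arcs_ends T"
  proof cases
    case 1
    then show ?thesis using edge spine_vertex[of "s - 2"] s by simp
  next
    case 2
    then show ?thesis using last_leaf[of v] by simp
  qed
qed (use spine_vertex[of "s - 1"] s in simp_all)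

lemma star_middle:
  assumes "1 \<le> m" "m + 1 < s"
  shows "has_star (q + 2) (m - 1, m + 1)"
proof (rule star_withinI[where c = m and S = "{m - 1, m + 1} \<union> {s + p..<s + p + q}"])
  have "card ({m - 1, m + 1} \<union> {s + p..<s + p + q}) = q + 2"
    using assms by (subst card_Un_disjoint) auto
  then show "q + 2 \<le> card ({m - 1, m + 1} \<union> {s + p..<s + p + q})"
    by simp
  have edges: "(m, m - 1) \<in> arcs_ends T" "(m, m + 1) \<in> arcs_ends T"
    using spine_edge(2)[of "m - 1"] spine_edge(1)[of m] assms by simp_all
  fix v assume "v \<in> {m - 1, m + 1} \<union> {s + p..<s + p + q}"
  then consider "v = m - 1" | "v = m + 1" | "v \<in> {s + p..<s + p + q}" by blast
  then show "v \<in> V \<and> m - 1 \<le> pos v \<and> pos v \<le> m + 1 \<and> (m, v) \<in> arcs_ends T"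
  proof cases
    case 3
    then show ?thesis using middle_leaf[of v] by simp
  qed (use edges spine_vertex[of v] assms in simp_all)
qed (use spine_vertex[of m] assms in simp_all)

lemma star_spine_edge:
  assumes "v + 1 < s"
  shows "has_star 1 (v, v + 1)"
proof (rule star_withinI[where c = v and S = "{v + 1}"])
  fix w assume "w \<in> {v + 1}"
  then show "w \<in> V \<and> v \<le> pos w \<and> pos w \<le> v + 1 \<and> (v, w) \<in> arcs_ends T"
    using spine_vertex[of "v + 1"] spine_edge(1)[OF assms] assms by simp
qed (use spine_vertex[of v] assms in simp_all)

end

section \<open>Witnesses of sharpness\<close>

lemma star_within_mono: "star_within E V pos k' j \<Longrightarrow> k \<le> k' \<Longrightarrow> star_within E V pos k j"
  unfolding star_within_def by (meson order_trans)

definition tree_with :: "nat \<Rightarrow> nat \<Rightarrow> nat \<Rightarrow> nat \<Rightarrow> (nat, nat \<times> nat) pre_digraph \<Rightarrow> bool" where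
  "tree_with k n l i T \<longleftrightarrow> undirected_tree T \<and> \<not> is_star T \<and> card (verts T) = n \<and>
     leaf_order T = l \<and> isolation_number k T = i"

context caterpillar
begin

lemma tree_with_T:
  assumes "isolation_number k T = i"
  shows "tree_with k (s + p + q + t) (p + q + t) i T"
  using assms undirected_tree_T not_star_T card_verts_T leaf_order_T by (simp add: tree_with_def)

lemmas upper_bounds =
  nonstar_tree.isolation_number_le_half_non_leaves[OF nonstar_tree_T, unfolded card_verts_T leaf_order_T]
  nonstar_tree.isolation_number_le_order[OF nonstar_tree_T, unfolded card_verts_T]
  nonstar_tree.isolation_number_le_order_leaf_order[OF nonstar_tree_T, unfolded card_verts_T leaf_order_T]

end

text \<open>
  The witnesses for \<open>k = 1\<close> are paths. In every witness below, the intervals give the lower bound, and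
  one of the three general upper bounds is attained.
\<close>

lemma tree_with_1_10_2_3: "\<exists>T. tree_with 1 10 2 3 T"
proof -
  interpret caterpillar 8 1 0 0 1 by unfold_locales auto
  have "card {(0, 0), (3, 4), (7 :: nat, 7 :: nat)} \<le> isolation_number 1 T"
    using star_first star_last star_spine_edge[of 3] by (intro isolation_number_ge_intervals) auto
  then have "isolation_number 1 T = 3"
    using upper_bounds(3)[of 1] by simp
  then show ?thesis
    using tree_with_T[of 1 3] by (intro exI[of _ T]) (simp add: tree_with_def)
qed

lemma tree_with_1_6_2_2: "\<exists>T. tree_with 1 6 2 2 T"
proof -
  interpret caterpillar 4 1 0 0 1 by unfold_locales auto
  have "card {(0, 0), (3 :: nat, 3 :: nat)} \<le> isolation_number 1 T"
    using star_first star_last by (intro isolation_number_ge_intervals) auto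
  then have "isolation_number 1 T = 2"
    using upper_bounds(2)[of 1] by simp
  then show ?thesis
    using tree_with_T[of 1 2] by (intro exI[of _ T]) (simp add: tree_with_def)
qed

lemma tree_with_1_4_2_1: "\<exists>T. tree_with 1 4 2 1 T"
proof -
  interpret caterpillar 2 1 0 0 1 by unfold_locales auto
  have "card {(0 :: nat, 0 :: nat)} \<le> isolation_number 1 T"
    using star_first by (intro isolation_number_ge_intervals) auto
  then have "isolation_number 1 T = 1"
    using upper_bounds(2)[of 1] by simp
  then show ?thesis
    using tree_with_T[of 1 1] by (intro exI[of _ T]) (simp add: tree_with_def)
qed

text \<open>
  Three stars centred on a spine, any two consecutive ones separated by two vertices. The outer stars
  have \<open>k - 1\<close> leaves and the middle one only \<open>k - 2\<close>, because two of its neighbours lie on the spine.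
\<close>

lemma tree_with_three_stars:
  assumes "2 \<le> k"
  shows "\<exists>T. tree_with k (3 * k + 7) (3 * k - 4) 3 T"
proof -
  interpret caterpillar 11 "k - 1" 5 "k - 2" "k - 1" using assms by unfold_locales auto
  have "has_star k (0, 1)" "has_star k (4, 6)" "has_star k (9, 10)"
    using star_first_spine star_middle star_last_spine le_add_diff_inverse2[OF assms] assms by simp_all
  then have "card {(0, 1), (4, 6), (9 :: nat, 10 :: nat)} \<le> isolation_number k T"
    by (intro isolation_number_ge_intervals) auto
  moreover have "(2 * k + 1) * isolation_number k T \<le> (2 * k + 1) * 3"
    using upper_bounds(3)[of k] assms by (simp add: max_def algebra_simps)
  ultimately have "isolation_number k T = 3"
    by (simp only: mult_le_cancel1) simp
  then have "tree_with k (11 + (k - 1) + (k - 2) + (k - 1)) (k - 1 + (k - 2) + (k - 1)) 3 T"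
    by (rule tree_with_T)
  moreover have "11 + (k - 1) + (k - 2) + (k - 1) = 3 * k + 7" "k - 1 + (k - 2) + (k - 1) = 3 * k - 4"
    using assms by auto
  ultimately show ?thesis by metis
qed

lemma tree_with_two_stars:
  assumes "2 \<le> k"
  shows "\<exists>T. tree_with k (2 * k + 4) (2 * k - 2) 2 T"
proof -
  interpret caterpillar 6 "k - 1" 0 0 "k - 1" using assms by unfold_locales auto
  have "has_star k (0, 1)" "has_star k (4, 5)"
    using star_first_spine star_last_spine assms by simp_all
  then have "card {(0, 1), (4 :: nat, 5 :: nat)} \<le> isolation_number k T"
    by (intro isolation_number_ge_intervals) auto
  moreover have "(k + 2) * isolation_number k T \<le> (k + 2) * 2"
    using upper_bounds(2)[of k] assms by (simp add: algebra_simps)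
  ultimately have "isolation_number k T = 2"
    by (simp only: mult_le_cancel1) simp
  then have "tree_with k (6 + (k - 1) + 0 + (k - 1)) (k - 1 + 0 + (k - 1)) 2 T"
    by (rule tree_with_T)
  moreover have "6 + (k - 1) + 0 + (k - 1) = 2 * k + 4" "k - 1 + 0 + (k - 1) = 2 * k - 2"
    using assms by auto
  ultimately show ?thesis by metis
qed

text \<open>
  The second star consists of leaves only, so it may be one step closer; this trades a spine vertex for
  a leaf and moves the leaf order strictly between the two thresholds.
\<close>

lemma tree_with_two_stars_extra_leaf:
  assumes "2 \<le> k"
  shows "\<exists>T. tree_with k (2 * k + 4) (2 * k - 1) 2 T"
proof -
  interpret caterpillar 5 "k - 1" 0 0 k using assms by unfold_locales auto
  have "has_star k (0, 1)" "has_star k (4, 4)"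
    using star_first_spine star_last assms by simp_all
  then have "card {(0, 1), (4 :: nat, 4 :: nat)} \<le> isolation_number k T"
    by (intro isolation_number_ge_intervals) auto
  moreover have "(k + 2) * isolation_number k T \<le> (k + 2) * 2"
    using upper_bounds(2)[of k] assms by (simp add: algebra_simps)
  ultimately have "isolation_number k T = 2"
    by (simp only: mult_le_cancel1) simp
  then have "tree_with k (5 + (k - 1) + 0 + k) (k - 1 + 0 + k) 2 T"
    by (rule tree_with_T)
  moreover have "5 + (k - 1) + 0 + k = 2 * k + 4" "k - 1 + 0 + k = 2 * k - 1"
    using assms by auto
  ultimately show ?thesis by metis
qed

lemma tree_with_double_star:
  assumes "2 \<le> k" "k \<le> l"
  shows "\<exists>T. tree_with k (l + 2) l 1 T"
proof -
  interpret caterpillar 2 "l - 1" 0 0 1 using assms by unfold_locales auto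
  have "has_star k (0, 1)"
    using star_within_mono[OF star_first_spine] assms by simp
  then have "card {(0 :: nat, 1 :: nat)} \<le> isolation_number k T"
    by (intro isolation_number_ge_intervals) auto
  moreover have "2 * isolation_number k T \<le> 2"
    using upper_bounds(1)[of k] assms by simp
  ultimately have "isolation_number k T = 1"
    by simp
  then have "tree_with k (2 + (l - 1) + 0 + 1) (l - 1 + 0 + 1) 1 T"
    by (rule tree_with_T)
  moreover have "2 + (l - 1) + 0 + 1 = l + 2" "l - 1 + 0 + 1 = l"
    using assms by auto
  ultimately show ?thesis by metis
qed

section \<open>The case distinctions on the leaf order\<close>

text \<open>
  What remains of both parts is arithmetic: each threshold for \<open>l\<close> is where two of the three bounds
  coincide.
\<close>

lemma cases_1:
  fixes n l i :: real
  assumes "2 * i + l \<le> n" "4 * i \<le> n + l"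
  shows "(l < n / 3 \<longrightarrow> i \<le> (n + l) / 4 \<and> (n + l) / 4 < n / 3) \<and>
    (l = n / 3 \<longrightarrow> i \<le> (n + l) / 4 \<and> (n + l) / 4 = (n - l) / 2 \<and> (n - l) / 2 = n / 3) \<and>
    (l > n / 3 \<longrightarrow> i \<le> (n - l) / 2 \<and> (n - l) / 2 < n / 3)"
  using assms by auto

lemma cases_ge_2:
  fixes n l i k :: real
  assumes A: "2 * i + l \<le> n" and B: "(k + 2) * i \<le> n" and C: "(2 * k + 1) * i \<le> n + l"
    and k: "2 \<le> k"
  defines "a \<equiv> (k - 1) / (k + 2) * n" and "b \<equiv> k / (k + 2) * n"
  shows "(l < a \<longrightarrow> i \<le> (n + l) / (2 * k + 1) \<and> (n + l) / (2 * k + 1) < n / (k + 2)) \<and>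
    (l = a \<longrightarrow> i \<le> (n + l) / (2 * k + 1) \<and> (n + l) / (2 * k + 1) = n / (k + 2)) \<and>
    (a < l \<and> l < b \<longrightarrow> i \<le> n / (k + 2)) \<and>
    (l = b \<longrightarrow> i \<le> (n - l) / 2 \<and> (n - l) / 2 = n / (k + 2)) \<and>
    (l > b \<longrightarrow> i \<le> (n - l) / 2 \<and> (n - l) / 2 < n / (k + 2))"
proof -
  have pos: "0 < k + 2" "0 < 2 * k + 1" using k by auto
  have iA: "i \<le> (n - l) / 2" using A by simp
  have iB: "i \<le> n / (k + 2)" using B pos by (simp add: pos_le_divide_eq mult.commute)
  have iC: "i \<le> (n + l) / (2 * k + 1)" using C pos by (simp add: pos_le_divide_eq mult.commute)
  have 1: "l < a \<longleftrightarrow> (n + l) / (2 * k + 1) < n / (k + 2)"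
    and 2: "l = a \<longleftrightarrow> (n + l) / (2 * k + 1) = n / (k + 2)"
    and 3: "l = b \<longleftrightarrow> (n - l) / 2 = n / (k + 2)"
    and 4: "b < l \<longleftrightarrow> (n - l) / 2 < n / (k + 2)"
    unfolding a_def b_def using pos by (auto simp: field_simps)
  show ?thesis
    using iA iB iC 1 2 3 4 by blast
qed

lemma tree_bounds:
  assumes "undirected_tree T" "\<not> is_star T" "1 \<le> k"
  defines "n \<equiv> real (card (verts T))" and "l \<equiv> real (leaf_order T)" and "i \<equiv> real (isolation_number k T)"
  shows "2 * i + l \<le> n" "(real k + 2) * i \<le> n" "(real k + 1 + max (real k) 2) * i \<le> n + l"
proof -
  interpret nonstar_tree T
    using assms(1,2) by (auto simp: nonstar_tree_def nonstar_tree_axioms_def undirected_tree_def)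
  have "real (2 * isolation_number k T + leaf_order T) \<le> real (card (verts T))"
    "real ((k + 2) * isolation_number k T) \<le> real (card (verts T))"
    "real ((k + 1 + max k 2) * isolation_number k T) \<le> real (card (verts T) + leaf_order T)"
    using isolation_number_le_half_non_leaves[OF assms(3)] isolation_number_le_order[OF assms(3)]
      isolation_number_le_order_leaf_order[OF assms(3)] by (simp_all only: of_nat_le_iff)
  then show "2 * i + l \<le> n" "(real k + 2) * i \<le> n" "(real k + 1 + max (real k) 2) * i \<le> n + l"
    unfolding n_def l_def i_def by (simp_all add: of_nat_max algebra_simps)
qed

theorem theorem1p5:
  shows
    "(\<forall>T :: ('a,'b) pre_digraph. undirected_tree T \<and> \<not> is_star T \<longrightarrow>
       (let n = real (card (verts T)); l = real (leaf_order T) in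
          (let i = real (isolation_number 1 T) in
             (l < n / 3 \<longrightarrow> i \<le> (n + l) / 4 \<and> (n + l) / 4 < n / 3) \<and>
             (l = n / 3 \<longrightarrow> i \<le> (n + l) / 4 \<and> (n + l) / 4 = (n - l) / 2 \<and> (n - l) / 2 = n / 3) \<and>
             (l > n / 3 \<longrightarrow> i \<le> (n - l) / 2 \<and> (n - l) / 2 < n / 3)) \<and>
          (\<forall>k::nat. k \<ge> 2 \<longrightarrow>
            (let i = real (isolation_number k T);
                 a = (real k - 1) / (real k + 2) * n;
                 b = real k / (real k + 2) * n
             in
             (l < a \<longrightarrow> i \<le> (n + l) / (2 * real k + 1) \<and>
                        (n + l) / (2 * real k + 1) < n / (real k + 2)) \<and>
             (l = a \<longrightarrow> i \<le> (n + l) / (2 * real k + 1) \<and>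
                        (n + l) / (2 * real k + 1) = n / (real k + 2)) \<and>
             (a < l \<and> l < b \<longrightarrow> i \<le> n / (real k + 2)) \<and>
             (l = b \<longrightarrow> i \<le> (n - l) / 2 \<and> (n - l) / 2 = n / (real k + 2)) \<and>
             (l > b \<longrightarrow> i \<le> (n - l) / 2 \<and> (n - l) / 2 < n / (real k + 2))))))
     \<and>
     (\<exists>T :: (nat, nat \<times> nat) pre_digraph. undirected_tree T \<and> \<not> is_star T \<and>
       (let n = real (card (verts T)); l = real (leaf_order T); i = real (isolation_number 1 T) in
          l < n / 3 \<and> i = (n + l) / 4)) \<and>
     (\<exists>T :: (nat, nat \<times> nat) pre_digraph. undirected_tree T \<and> \<not> is_star T \<and>
       (let n = real (card (verts T)); l = real (leaf_order T); i = real (isolation_number 1 T) in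
          l = n / 3 \<and> i = (n + l) / 4)) \<and>
     (\<exists>T :: (nat, nat \<times> nat) pre_digraph. undirected_tree T \<and> \<not> is_star T \<and>
       (let n = real (card (verts T)); l = real (leaf_order T); i = real (isolation_number 1 T) in
          l > n / 3 \<and> i = (n - l) / 2))
     \<and>
     (\<forall>k::nat. k \<ge> 2 \<longrightarrow>
       (\<exists>T :: (nat, nat \<times> nat) pre_digraph. undirected_tree T \<and> \<not> is_star T \<and>
         (let n = real (card (verts T)); l = real (leaf_order T); i = real (isolation_number k T) in
            l < (real k - 1) / (real k + 2) * n \<and> i = (n + l) / (2 * real k + 1))) \<and>
       (\<exists>T :: (nat, nat \<times> nat) pre_digraph. undirected_tree T \<and> \<not> is_star T \<and>
         (let n = real (card (verts T)); l = real (leaf_order T); i = real (isolation_number k T) in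
            l = (real k - 1) / (real k + 2) * n \<and> i = (n + l) / (2 * real k + 1))) \<and>
       (\<exists>T :: (nat, nat \<times> nat) pre_digraph. undirected_tree T \<and> \<not> is_star T \<and>
         (let n = real (card (verts T)); l = real (leaf_order T); i = real (isolation_number k T) in
            (real k - 1) / (real k + 2) * n < l \<and> l < real k / (real k + 2) * n \<and>
            i = n / (real k + 2))) \<and>
       (\<exists>T :: (nat, nat \<times> nat) pre_digraph. undirected_tree T \<and> \<not> is_star T \<and>
         (let n = real (card (verts T)); l = real (leaf_order T); i = real (isolation_number k T) in
            l = real k / (real k + 2) * n \<and> i = (n - l) / 2)) \<and>
       (\<exists>T :: (nat, nat \<times> nat) pre_digraph. undirected_tree T \<and> \<not> is_star T \<and>
         (let n = real (card (verts T)); l = real (leaf_order T); i = real (isolation_number k T) in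
            l > real k / (real k + 2) * n \<and> i = (n - l) / 2)))"

  unfolding Let_def
proof (rule conjI, goal_cases)
  case 1
  show ?case
  proof (intro allI impI, goal_cases)
    case (1 T)
    then have T: "undirected_tree T" "\<not> is_star T" by auto
    show ?case
    proof (rule conjI, goal_cases)
      case 1
      show ?case
        using tree_bounds[OF T, of 1] by (intro cases_1) simp_all
    next
      case 2
      show ?case
      proof (intro allI impI, goal_cases)
        case (1 k)
        then show ?case
          using tree_bounds[OF T, of k] by (intro cases_ge_2) simp_all
      qed
    qed
  qed
next
  case 2
  show ?case
  proof (intro conjI allI impI, goal_cases)
    case 1
    obtain T where "tree_with 1 10 2 3 T" using tree_with_1_10_2_3 by blast
    then show ?case by (intro exI[of _ T]) (simp add: tree_with_def)
  next
    case 2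
    obtain T where "tree_with 1 6 2 2 T" using tree_with_1_6_2_2 by blast
    then show ?case by (intro exI[of _ T]) (simp add: tree_with_def)
  next
    case 3
    obtain T where "tree_with 1 4 2 1 T" using tree_with_1_4_2_1 by blast
    then show ?case by (intro exI[of _ T]) (simp add: tree_with_def)
  next
    case (4 k)
    obtain T where "tree_with k (3 * k + 7) (3 * k - 4) 3 T" using tree_with_three_stars[OF 4] by blast
    then show ?case using 4
      by (intro exI[of _ T]) (simp add: tree_with_def of_nat_diff field_simps)
  next
    case (5 k)
    obtain T where "tree_with k (2 * k + 4) (2 * k - 2) 2 T" using tree_with_two_stars[OF 5] by blast
    then show ?case using 5
      by (intro exI[of _ T]) (simp add: tree_with_def of_nat_diff field_simps)
  next
    case (6 k)
    obtain T where "tree_with k (2 * k + 4) (2 * k - 1) 2 T"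
      using tree_with_two_stars_extra_leaf[OF 6] by blast
    then show ?case using 6
      by (intro exI[of _ T]) (simp add: tree_with_def of_nat_diff field_simps)
  next
    case (7 k)
    obtain T where "tree_with k (k + 2) k 1 T" using tree_with_double_star[OF 7] by blast
    then show ?case using 7
      by (intro exI[of _ T]) (simp add: tree_with_def field_simps)
  next
    case (8 k)
    obtain T where "tree_with k (k + 1 + 2) (k + 1) 1 T"
      using tree_with_double_star[OF 8, of "k + 1"] by auto
    then show ?case using 8
      by (intro exI[of _ T]) (simp add: tree_with_def field_simps)
  qed
qed

end
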